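(* Let $\mathcal{A}$ be a bicomplete, locally small abelian category and let $\tau:T\hookrightarrow1_{\mathcal{A}}$ be any preradical of $\mathcal{A}$, with cokernel $\tau^*:1_{\mathcal{A}}\twoheadrightarrow T^*$. Then $$\tau=\bigwedge_{M\in\mathcal{A}}\omega_{\tau^*_M},$$ where, for each $M\in\mathcal{A}$, $\tau^*_M:M\to T^*(M)$ is the corresponding component of $\tau^*$ (a cokernel of $\tau_M:T(M)\to M$).
   Context: Bicomplete means complete and cocomplete; locally small means that the class of subobjects of each object is a set; Hom-classes are sets. A preradical of an abelian category $\mathcal{A}$ is a subobject of the identity functor $1_{\mathcal{A}}$ in the (possibly extended) abelian category $\mathrm{Fun}(\mathcal{A},\mathcal{A})$, i.e. the equivalence class of a monomorphic natural transformation $\tau:T\hookrightarrow 1_{\mathcal{A}}$, two such being equivalent if each factors through the other. $Pr(\mathcal{A})$ is the collection of preradicals, ordered by $\tau\leq\sigma$ iff $\tau$ factors through $\sigma$; under the stated hypotheses on $\mathcal{A}$ every collection of preradicals (not necessarily a set) has a join $\bigvee$ and a meet $\bigwedge$. Omega preradicals: for objects $N,M$ of $\mathcal{A}$, $\mathbb{W}_M^N:\mathcal{A}\to\mathcal{A}$ is the functor $L\mapsto M^{\mathrm{Hom}_{\mathcal{A}}(L,N)}$ (product of copies of $M$ indexed by $\mathrm{Hom}_{\mathcal{A}}(L,N)$, with projections $\pi_f$), the composite of the contravariant functors $\mathrm{Hom}_{\mathcal{A}}(-,N)$ and $M^{-}$. For a morphism $k:N\to M$, $\mathbf{W}_k:1_{\mathcal{A}}\to\mathbb{W}_M^N$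 is the natural transformation determined by $\pi_f\circ[\mathbf{W}_k]_L=k\circ f$ for all $L$ and all $f\in\mathrm{Hom}_{\mathcal{A}}(L,N)$. The omega preradical associated to $k$ is $\omega_k:=\mathrm{Ker}(\mathbf{W}_k)$. *)

theory Defs
  imports "HOL-Algebra.Lattice" "HOL-Library.Equipollence"
begin

section \<open>Sets versus classes\<close>

text \<open>
  The distinction between sets and classes is made relative to a universe, given by a type
  \<open>'u\<close>: a collection counts as a set if it has strictly fewer elements than \<open>'u\<close>. The closure
  conditions say that the cardinality of \<open>'u\<close> is a regular strong limit, i.e. that the collections
  of this kind are, up to bijection, the elements of a Grothendieck universe (the hereditarily
  finite sets, \<open>'u = nat\<close>, are not excluded). The objects and the morphisms of a category
  are subject to no size restriction.
\<close>

definition small :: "'u itself \<Rightarrow> 'a set \<Rightarrow> bool" where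
  "small U S \<longleftrightarrow> S \<prec> (UNIV :: 'u set)"

definition grothendieck_universe :: "'u itself \<Rightarrow> bool" where
  "grothendieck_universe U \<longleftrightarrow>
     (\<forall>S :: 'u set. small U S \<longrightarrow> small U (Pow S)) \<and>
     (\<forall>(S :: 'u set) (F :: 'u \<Rightarrow> 'u set).
        small U S \<and> (\<forall>i\<in>S. small U (F i)) \<longrightarrow> small U (\<Union>i\<in>S. F i))"


section \<open>Categories\<close>

text \<open>\<open>g \<cdot>\<^bsub>C\<^esub> f\<close> is the composite \<open>g\<close> after \<open>f\<close>.\<close>

record ('o, 'm) cat =
  Obj :: "'o set"
  Arr :: "'m set"
  Dom :: "'m \<Rightarrow> 'o"
  Cod :: "'m \<Rightarrow> 'o"
  Ident :: "'o \<Rightarrow> 'm"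
  Comp :: "'m \<Rightarrow> 'm \<Rightarrow> 'm" (infixl \<open>\<cdot>\<index>\<close> 70)

locale category =
  fixes C :: "('o, 'm) cat" (structure)
  assumes Dom_closed: "f \<in> Arr C \<Longrightarrow> Dom C f \<in> Obj C"
    and Cod_closed: "f \<in> Arr C \<Longrightarrow> Cod C f \<in> Obj C"
    and Ident_closed: "X \<in> Obj C \<Longrightarrow> Ident C X \<in> Arr C"
    and Dom_Ident: "X \<in> Obj C \<Longrightarrow> Dom C (Ident C X) = X"
    and Cod_Ident: "X \<in> Obj C \<Longrightarrow> Cod C (Ident C X) = X"
    and Comp_closed: "\<lbrakk>g \<in> Arr C; f \<in> Arr C; Dom C g = Cod C f\<rbrakk> \<Longrightarrow> g \<cdot> f \<in> Arr C"
    and Dom_Comp: "\<lbrakk>g \<in> Arr C; f \<in> Arr C; Dom C g = Cod C f\<rbrakk> \<Longrightarrow> Dom C (g \<cdot> f) = Dom C f"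
    and Cod_Comp: "\<lbrakk>g \<in> Arr C; f \<in> Arr C; Dom C g = Cod C f\<rbrakk> \<Longrightarrow> Cod C (g \<cdot> f) = Cod C g"
    and Comp_Ident: "f \<in> Arr C \<Longrightarrow> f \<cdot> Ident C (Dom C f) = f"
    and Ident_Comp: "f \<in> Arr C \<Longrightarrow> Ident C (Cod C f) \<cdot> f = f"
    and Comp_assoc: "\<lbrakk>h \<in> Arr C; g \<in> Arr C; f \<in> Arr C; Dom C h = Cod C g; Dom C g = Cod C f\<rbrakk>
                       \<Longrightarrow> (h \<cdot> g) \<cdot> f = h \<cdot> (g \<cdot> f)"

definition hom :: "('o, 'm) cat \<Rightarrow> 'o \<Rightarrow> 'o \<Rightarrow> 'm set" where
  "hom C X Y = {f \<in> Arr C. Dom C f = X \<and> Cod C f = Y}"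

definition op_cat :: "('o, 'm) cat \<Rightarrow> ('o, 'm) cat" where
  "op_cat C = \<lparr>Obj = Obj C, Arr = Arr C, Dom = Cod C, Cod = Dom C, Ident = Ident C,
               Comp = (\<lambda>g f. f \<cdot>\<^bsub>C\<^esub> g)\<rparr>"

definition monic :: "('o, 'm) cat \<Rightarrow> 'm \<Rightarrow> bool" where
  "monic C m \<longleftrightarrow> m \<in> Arr C \<and>
     (\<forall>g\<in>Arr C. \<forall>h\<in>Arr C. Cod C g = Dom C m \<and> Cod C h = Dom C m \<and> Dom C g = Dom C h \<and>
        m \<cdot>\<^bsub>C\<^esub> g = m \<cdot>\<^bsub>C\<^esub> h \<longrightarrow> g = h)"

definition epic :: "('o, 'm) cat \<Rightarrow> 'm \<Rightarrow> bool" where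
  "epic C e \<longleftrightarrow> monic (op_cat C) e"


section \<open>Functors and natural transformations\<close>

text \<open>
  The maps are required to be extensional, so that equality in HOL of functors and of natural
  transformations is the mathematical one.
\<close>

record ('o, 'm, 'p, 'n) cat_functor =
  fobj :: "'o \<Rightarrow> 'p"
  farr :: "'m \<Rightarrow> 'n"

definition is_functor ::
    "('o, 'm) cat \<Rightarrow> ('p, 'n) cat \<Rightarrow> ('o, 'm, 'p, 'n) cat_functor \<Rightarrow> bool" where
  "is_functor C D F \<longleftrightarrow>
     fobj F \<in> Obj C \<rightarrow>\<^sub>E Obj D \<and> farr F \<in> Arr C \<rightarrow>\<^sub>E Arr D \<and>
     (\<forall>f\<in>Arr C. Dom D (farr F f) = fobj F (Dom C f) \<and> Cod D (farr F f) = fobj F (Cod C f)) \<and>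
     (\<forall>X\<in>Obj C. farr F (Ident C X) = Ident D (fobj F X)) \<and>
     (\<forall>g\<in>Arr C. \<forall>f\<in>Arr C. Dom C g = Cod C f \<longrightarrow>
        farr F (g \<cdot>\<^bsub>C\<^esub> f) = farr F g \<cdot>\<^bsub>D\<^esub> farr F f)"

definition id_functor :: "('o, 'm) cat \<Rightarrow> ('o, 'm, 'o, 'm) cat_functor" where
  "id_functor C = \<lparr>fobj = (\<lambda>X\<in>Obj C. X), farr = (\<lambda>f\<in>Arr C. f)\<rparr>"

record ('o, 'm, 'p, 'n) nat_trans =
  nt_dom :: "('o, 'm, 'p, 'n) cat_functor"
  nt_cod :: "('o, 'm, 'p, 'n) cat_functor"
  component :: "'o \<Rightarrow> 'n"

definition is_nat_trans ::
    "('o, 'm) cat \<Rightarrow> ('p, 'n) cat \<Rightarrow> ('o, 'm, 'p, 'n) nat_trans \<Rightarrow> bool" where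
  "is_nat_trans C D \<eta> \<longleftrightarrow>
     is_functor C D (nt_dom \<eta>) \<and> is_functor C D (nt_cod \<eta>) \<and>
     component \<eta> \<in> extensional (Obj C) \<and>
     (\<forall>X\<in>Obj C. component \<eta> X \<in> hom D (fobj (nt_dom \<eta>) X) (fobj (nt_cod \<eta>) X)) \<and>
     (\<forall>f\<in>Arr C. component \<eta> (Cod C f) \<cdot>\<^bsub>D\<^esub> farr (nt_dom \<eta>) f
                = farr (nt_cod \<eta>) f \<cdot>\<^bsub>D\<^esub> component \<eta> (Dom C f))"

definition functor_cat :: "('o, 'm) cat \<Rightarrow> ('p, 'n) cat \<Rightarrow>
    (('o, 'm, 'p, 'n) cat_functor, ('o, 'm, 'p, 'n) nat_trans) cat" where
  "functor_cat C D =
     \<lparr>Obj = {F. is_functor C D F},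
      Arr = {\<eta>. is_nat_trans C D \<eta>},
      Dom = nt_dom,
      Cod = nt_cod,
      Ident = (\<lambda>F. \<lparr>nt_dom = F, nt_cod = F, component = (\<lambda>X\<in>Obj C. Ident D (fobj F X))\<rparr>),
      Comp = (\<lambda>\<eta> \<theta>. \<lparr>nt_dom = nt_dom \<theta>, nt_cod = nt_cod \<eta>,
                     component = (\<lambda>X\<in>Obj C. component \<eta> X \<cdot>\<^bsub>D\<^esub> component \<theta> X)\<rparr>)\<rparr>"


section \<open>Products, limits and bicompleteness\<close>

definition is_product ::
    "('o, 'm) cat \<Rightarrow> 'i set \<Rightarrow> ('i \<Rightarrow> 'o) \<Rightarrow> 'o \<Rightarrow> ('i \<Rightarrow> 'm) \<Rightarrow> bool" where
  "is_product C I X P \<pi> \<longleftrightarrow>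
     P \<in> Obj C \<and> (\<forall>i\<in>I. \<pi> i \<in> hom C P (X i)) \<and>
     (\<forall>Q\<in>Obj C. \<forall>q. (\<forall>i\<in>I. q i \<in> hom C Q (X i)) \<longrightarrow>
        (\<exists>!h. h \<in> hom C Q P \<and> (\<forall>i\<in>I. \<pi> i \<cdot>\<^bsub>C\<^esub> h = q i)))"

definition is_cone :: "('j, 'a) cat \<Rightarrow> ('o, 'm) cat \<Rightarrow> ('j, 'a, 'o, 'm) cat_functor \<Rightarrow>
    'o \<Rightarrow> ('j \<Rightarrow> 'm) \<Rightarrow> bool" where
  "is_cone J C D X \<nu> \<longleftrightarrow>
     X \<in> Obj C \<and> (\<forall>j\<in>Obj J. \<nu> j \<in> hom C X (fobj D j)) \<and>
     (\<forall>a\<in>Arr J. farr D a \<cdot>\<^bsub>C\<^esub> \<nu> (Dom J a) = \<nu> (Cod J a))"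

definition is_limit :: "('j, 'a) cat \<Rightarrow> ('o, 'm) cat \<Rightarrow> ('j, 'a, 'o, 'm) cat_functor \<Rightarrow>
    'o \<Rightarrow> ('j \<Rightarrow> 'm) \<Rightarrow> bool" where
  "is_limit J C D X \<nu> \<longleftrightarrow>
     is_cone J C D X \<nu> \<and>
     (\<forall>Y \<mu>. is_cone J C D Y \<mu> \<longrightarrow>
        (\<exists>!h. h \<in> hom C Y X \<and> (\<forall>j\<in>Obj J. \<nu> j \<cdot>\<^bsub>C\<^esub> h = \<mu> j)))"

text \<open>Up to isomorphism, every small category is one whose objects and arrows are taken from \<open>'u\<close>.\<close>

definition complete_cat :: "'u itself \<Rightarrow> ('o, 'm) cat \<Rightarrow> bool" where
  "complete_cat U C \<longleftrightarrow>
     (\<forall>(J :: ('u, 'u) cat) D. category J \<and> small U (Obj J) \<and> small U (Arr J) \<and> is_functor J C D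
        \<longrightarrow> (\<exists>X \<nu>. is_limit J C D X \<nu>))"

definition bicomplete :: "'u itself \<Rightarrow> ('o, 'm) cat \<Rightarrow> bool" where
  "bicomplete U C \<longleftrightarrow> complete_cat U C \<and> complete_cat U (op_cat C)"


section \<open>Kernels and abelian categories\<close>

definition zero_object :: "('o, 'm) cat \<Rightarrow> 'o \<Rightarrow> bool" where
  "zero_object C Z \<longleftrightarrow>
     Z \<in> Obj C \<and> (\<forall>X\<in>Obj C. (\<exists>!f. f \<in> hom C X Z) \<and> (\<exists>!f. f \<in> hom C Z X))"

definition zero_arrow :: "('o, 'm) cat \<Rightarrow> 'm \<Rightarrow> bool" where
  "zero_arrow C f \<longleftrightarrow>
     f \<in> Arr C \<and>
     (\<exists>Z u v. zero_object C Z \<and> u \<in> hom C (Dom C f) Z \<and> v \<in> hom C Z (Cod C f) \<and> f = v \<cdot>\<^bsub>C\<^esub> u)"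

definition is_kernel :: "('o, 'm) cat \<Rightarrow> 'm \<Rightarrow> 'm \<Rightarrow> bool" where
  "is_kernel C f k \<longleftrightarrow>
     f \<in> Arr C \<and> k \<in> Arr C \<and> Cod C k = Dom C f \<and> zero_arrow C (f \<cdot>\<^bsub>C\<^esub> k) \<and>
     (\<forall>h\<in>Arr C. Cod C h = Dom C f \<and> zero_arrow C (f \<cdot>\<^bsub>C\<^esub> h) \<longrightarrow>
        (\<exists>!u. u \<in> hom C (Dom C h) (Dom C k) \<and> k \<cdot>\<^bsub>C\<^esub> u = h))"

definition is_cokernel :: "('o, 'm) cat \<Rightarrow> 'm \<Rightarrow> 'm \<Rightarrow> bool" where
  "is_cokernel C f c \<longleftrightarrow> is_kernel (op_cat C) f c"

text \<open>
  Freyd's axioms for abelian categories; the additive structure on the Hom-classes is a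
  consequence of them and is uniquely determined.
\<close>

locale abelian_category = category C for C :: "('o, 'm) cat" (structure) +
  assumes has_zero_object: "\<exists>Z. zero_object C Z"
    and has_binary_products: "\<lbrakk>X \<in> Obj C; Y \<in> Obj C\<rbrakk> \<Longrightarrow>
      \<exists>P \<pi>. is_product C UNIV (\<lambda>b::bool. if b then X else Y) P \<pi>"
    and has_binary_coproducts: "\<lbrakk>X \<in> Obj C; Y \<in> Obj C\<rbrakk> \<Longrightarrow>
      \<exists>P \<pi>. is_product (op_cat C) UNIV (\<lambda>b::bool. if b then X else Y) P \<pi>"
    and has_kernels: "f \<in> Arr C \<Longrightarrow> \<exists>k. is_kernel C f k"
    and has_cokernels: "f \<in> Arr C \<Longrightarrow> \<exists>c. is_cokernel C f c"
    and monic_is_kernel: "monic C m \<Longrightarrow> \<exists>f. is_kernel C f m"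
    and epic_is_cokernel: "epic C e \<Longrightarrow> \<exists>f. is_cokernel C f e"


section \<open>Subobjects\<close>

definition factors_through :: "('o, 'm) cat \<Rightarrow> 'm \<Rightarrow> 'm \<Rightarrow> bool" where
  "factors_through C m n \<longleftrightarrow> (\<exists>h \<in> hom C (Dom C m) (Dom C n). m = n \<cdot>\<^bsub>C\<^esub> h)"

definition monics_into :: "('o, 'm) cat \<Rightarrow> 'o \<Rightarrow> 'm set" where
  "monics_into C X = {m. monic C m \<and> Cod C m = X}"

definition subobjects :: "('o, 'm) cat \<Rightarrow> 'o \<Rightarrow> 'm set set" where
  "subobjects C X = monics_into C X //
     {(m, n). m \<in> monics_into C X \<and> n \<in> monics_into C X \<and>
              factors_through C m n \<and> factors_through C n m}"

definition subobject_order :: "('o, 'm) cat \<Rightarrow> 'o \<Rightarrow> 'm set gorder" where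
  "subobject_order C X =
     \<lparr>carrier = subobjects C X, eq = (=),
      le = (\<lambda>s t. \<exists>m\<in>s. \<exists>n\<in>t. factors_through C m n)\<rparr>"

definition small_homs :: "'u itself \<Rightarrow> ('o, 'm) cat \<Rightarrow> bool" where
  "small_homs U C \<longleftrightarrow> (\<forall>X\<in>Obj C. \<forall>Y\<in>Obj C. small U (hom C X Y))"

text \<open>Local smallness refers to subobjects, not to Hom-classes.\<close>

definition locally_small :: "'u itself \<Rightarrow> ('o, 'm) cat \<Rightarrow> bool" where
  "locally_small U C \<longleftrightarrow> (\<forall>X\<in>Obj C. small U (subobjects C X))"

text \<open>The kernels of \<open>f\<close> form exactly one equivalence class of monomorphisms into the domain of \<open>f\<close>.\<close>

definition Ker :: "('o, 'm) cat \<Rightarrow> 'm \<Rightarrow> 'm set" where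
  "Ker C f = {k. is_kernel C f k}"


section \<open>Preradicals\<close>

definition Pr :: "('o, 'm) cat \<Rightarrow> ('o, 'm, 'o, 'm) nat_trans set gorder" where
  "Pr C = subobject_order (functor_cat C C) (id_functor C)"

text \<open>\<open>power_obj C M I\<close> is the product \<open>M\<^sup>I\<close>, with projections \<open>power_proj C M I i\<close>.\<close>

definition power :: "('o, 'm) cat \<Rightarrow> 'o \<Rightarrow> 'i set \<Rightarrow> 'o \<times> ('i \<Rightarrow> 'm)" where
  "power C M I = (SOME P\<pi>. is_product C I (\<lambda>i. M) (fst P\<pi>) (snd P\<pi>))"

definition power_obj :: "('o, 'm) cat \<Rightarrow> 'o \<Rightarrow> 'i set \<Rightarrow> 'o" where
  "power_obj C M I = fst (power C M I)"

definition power_proj :: "('o, 'm) cat \<Rightarrow> 'o \<Rightarrow> 'i set \<Rightarrow> 'i \<Rightarrow> 'm" where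
  "power_proj C M I = snd (power C M I)"

definition power_lift :: "('o, 'm) cat \<Rightarrow> 'o \<Rightarrow> 'i set \<Rightarrow> 'o \<Rightarrow> ('i \<Rightarrow> 'm) \<Rightarrow> 'm" where
  "power_lift C M I Q q =
     (THE h. h \<in> hom C Q (power_obj C M I) \<and> (\<forall>i\<in>I. power_proj C M I i \<cdot>\<^bsub>C\<^esub> h = q i))"

text \<open>The morphism \<open>M\<^sup>\<phi> : M\<^sup>J \<rightarrow> M\<^sup>I\<close> induced by a map \<open>\<phi> : I \<rightarrow> J\<close>.\<close>

definition power_map :: "('o, 'm) cat \<Rightarrow> 'o \<Rightarrow> 'i set \<Rightarrow> 'j set \<Rightarrow> ('i \<Rightarrow> 'j) \<Rightarrow> 'm" where
  "power_map C M I J \<phi> = power_lift C M I (power_obj C M J) (\<lambda>i. power_proj C M J (\<phi> i))"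

definition omega_functor :: "('o, 'm) cat \<Rightarrow> 'o \<Rightarrow> 'o \<Rightarrow> ('o, 'm, 'o, 'm) cat_functor" where
  "omega_functor C N M =
     \<lparr>fobj = (\<lambda>L\<in>Obj C. power_obj C M (hom C L N)),
      farr = (\<lambda>g\<in>Arr C. power_map C M (hom C (Cod C g) N) (hom C (Dom C g) N) (\<lambda>f. f \<cdot>\<^bsub>C\<^esub> g))\<rparr>"

definition omega_trans :: "('o, 'm) cat \<Rightarrow> 'm \<Rightarrow> ('o, 'm, 'o, 'm) nat_trans" where
  "omega_trans C k =
     \<lparr>nt_dom = id_functor C,
      nt_cod = omega_functor C (Dom C k) (Cod C k),
      component = (\<lambda>L\<in>Obj C. power_lift C (Cod C k) (hom C L (Dom C k)) L (\<lambda>f. k \<cdot>\<^bsub>C\<^esub> f))\<rparr>"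

definition omega :: "('o, 'm) cat \<Rightarrow> 'm \<Rightarrow> ('o, 'm, 'o, 'm) nat_trans set" where
  "omega C k = Ker (functor_cat C C) (omega_trans C k)"

end

theory Submission
  imports Defs
begin

text \<open>
  A transformation \<open>\<sigma>\<close> is annihilated by \<open>\<^bold>W\<^sub>k\<close> iff \<open>k \<cdot> f \<cdot> \<sigma>\<^sub>L = 0\<close> for all \<open>f : L \<rightarrow> N\<close>. For
  \<open>k = \<tau>'\<^sub>M\<close> and \<open>\<sigma> = \<tau>\<close> this holds by naturality, so \<open>\<tau>\<close> is a lower bound of the omega
  preradicals. If \<open>\<sigma>\<close> is another lower bound, then \<open>f = 1\<^sub>M\<close> gives \<open>\<tau>' \<cdot> \<sigma> = 0\<close>, and \<open>\<sigma>\<close>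
  factors through \<open>\<tau>\<close> because the monomorphism \<open>\<tau>\<close> is the kernel of its cokernel. The last
  fact is reduced to the components: kernels and cokernels in the functor category are computed
  pointwise, and a monomorphism there has zero kernel, hence monic components.
\<close>


section \<open>Monomorphisms, zero arrows and kernels\<close>

text \<open>Freyd's axioms come without a subtraction of arrows, so
  \<open>f \<cdot> x = f \<cdot> y\<close> cannot be turned into \<open>f\<close> annihilating a
  difference. Passing from a zero kernel to monicity therefore uses a coequaliser, and
  (co)equalisers have to be built from kernels and binary products beforehand. A second obstacle is
  that \<open>\<tau>'\<close> is an arbitrary cokernel in the functor category, with nothing given
  about its components. Instead of proving the functor category abelian, the argument builds a
  second transformation out of cokernels of the components and uses only that it factors through
  \<open>\<tau>'\<close>. These cokernels come from the kernel construction applied to opposite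
  categories. Completeness and small Hom-sets guarantee the powers that define the omega functors.
  The meet ranges over all objects, possibly a large collection, so it is not constructed: the
  universal property is verified for the given preradical.\<close>

context category
begin

lemma homD: "f \<in> hom C X Y \<Longrightarrow> f \<in> Arr C \<and> Dom C f = X \<and> Cod C f = Y \<and> X \<in> Obj C \<and> Y \<in> Obj C"
  by (auto simp: hom_def Dom_closed Cod_closed)

lemma Arr_hom: "f \<in> Arr C \<Longrightarrow> f \<in> hom C (Dom C f) (Cod C f)"
  by (simp add: hom_def)

lemma Ident_hom: "X \<in> Obj C \<Longrightarrow> Ident C X \<in> hom C X X"
  by (simp add: hom_def Ident_closed Dom_Ident Cod_Ident)

lemma comp_hom: "\<lbrakk>g \<in> hom C Y Z; f \<in> hom C X Y\<rbrakk> \<Longrightarrow> g \<cdot> f \<in> hom C X Z"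
  by (simp add: hom_def Comp_closed Dom_Comp Cod_Comp)

lemma hom_assoc:
  "\<lbrakk>h \<in> hom C Z W; g \<in> hom C Y Z; f \<in> hom C X Y\<rbrakk> \<Longrightarrow> (h \<cdot> g) \<cdot> f = h \<cdot> (g \<cdot> f)"
  by (simp add: hom_def Comp_assoc)

lemma hom_Ident_right: "f \<in> hom C X Y \<Longrightarrow> f \<cdot> Ident C X = f"
  using Comp_Ident by (auto simp: hom_def)

lemma hom_Ident_left: "f \<in> hom C X Y \<Longrightarrow> Ident C Y \<cdot> f = f"
  using Ident_Comp by (auto simp: hom_def)

lemma monicI:
  assumes "m \<in> hom C X Y"
    and "\<And>Q g h. \<lbrakk>g \<in> hom C Q X; h \<in> hom C Q X; m \<cdot> g = m \<cdot> h\<rbrakk> \<Longrightarrow> g = h"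
  shows "monic C m"
  using assms unfolding monic_def hom_def by blast

lemma monicD:
  assumes "monic C m" "m \<in> hom C X Y" "g \<in> hom C Q X" "h \<in> hom C Q X" "m \<cdot> g = m \<cdot> h"
  shows "g = h"
proof -
  have "\<forall>g\<in>Arr C. \<forall>h\<in>Arr C. Cod C g = Dom C m \<and> Cod C h = Dom C m \<and> Dom C g = Dom C h \<and>
      m \<cdot> g = m \<cdot> h \<longrightarrow> g = h"
    using assms(1) unfolding monic_def by (elim conjE)
  from bspec[OF bspec[OF this, of g], of h] show ?thesis
    using assms(5) homD[OF assms(2)] homD[OF assms(3)] homD[OF assms(4)] by simp
qed

lemma split_monic:
  assumes "m \<in> hom C X Y" "r \<in> hom C Y X" "r \<cdot> m = Ident C X"
  shows "monic C m"
proof (rule monicI[OF assms(1)])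
  fix Q g h assume gh: "g \<in> hom C Q X" "h \<in> hom C Q X" "m \<cdot> g = m \<cdot> h"
  have "g = r \<cdot> (m \<cdot> g)"
    using hom_assoc[OF assms(2,1) gh(1)] assms(3) hom_Ident_left[OF gh(1)] by simp
  also have "\<dots> = h"
    using hom_assoc[OF assms(2,1) gh(2)] assms(3) hom_Ident_left[OF gh(2)] gh(3) by simp
  finally show "g = h" .
qed

section \<open>Zero objects and zero arrows\<close>

lemma zero_objectD:
  assumes "zero_object C Z" "X \<in> Obj C"
  shows "\<exists>f. f \<in> hom C X Z" "\<exists>f. f \<in> hom C Z X"
    and "\<And>f g. \<lbrakk>f \<in> hom C X Z; g \<in> hom C X Z\<rbrakk> \<Longrightarrow> f = g"
    and "\<And>f g. \<lbrakk>f \<in> hom C Z X; g \<in> hom C Z X\<rbrakk> \<Longrightarrow> f = g"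
  using assms unfolding zero_object_def by blast+

lemma zero_arrowI:
  assumes "zero_object C Z" "u \<in> hom C X Z" "v \<in> hom C Z Y"
  shows "zero_arrow C (v \<cdot> u)"
  using assms homD[OF comp_hom[OF assms(3,2)]] unfolding zero_arrow_def by blast

lemma zero_arrowE:
  assumes "zero_arrow C f" "f \<in> hom C X Y"
  obtains Z u v where "zero_object C Z" "u \<in> hom C X Z" "v \<in> hom C Z Y" "f = v \<cdot> u"
  using assms unfolding zero_arrow_def hom_def by blast

lemma zero_arrow_comp_right:
  assumes "zero_arrow C f" "f \<in> hom C X Y" "g \<in> hom C W X"
  shows "zero_arrow C (f \<cdot> g)"
proof -
  obtain Z u v where z: "zero_object C Z" "u \<in> hom C X Z" "v \<in> hom C Z Y" "f = v \<cdot> u"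
    using zero_arrowE[OF assms(1,2)] .
  then show ?thesis
    using hom_assoc[OF z(3,2) assms(3)] zero_arrowI[OF z(1) comp_hom[OF z(2) assms(3)] z(3)] by simp
qed

lemma zero_arrow_comp_left:
  assumes "zero_arrow C f" "f \<in> hom C X Y" "g \<in> hom C Y W"
  shows "zero_arrow C (g \<cdot> f)"
proof -
  obtain Z u v where z: "zero_object C Z" "u \<in> hom C X Z" "v \<in> hom C Z Y" "f = v \<cdot> u"
    using zero_arrowE[OF assms(1,2)] .
  then show ?thesis
    using hom_assoc[OF assms(3) z(3,2)] zero_arrowI[OF z(1,2) comp_hom[OF assms(3) z(3)]] by simp
qed

text \<open>The arrow between the two zero objects is compatible with the arrows into and out of
  them, by uniqueness. So a factorisation through one zero object can be moved to any other, with
  prescribed legs.\<close>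

lemma zero_arrow_factors:
  assumes "zero_arrow C f" "f \<in> hom C X Y" "zero_object C Z"
    and "u \<in> hom C X Z" "v \<in> hom C Z Y"
  shows "f = v \<cdot> u"
proof -
  obtain Z' u' v' where z: "zero_object C Z'" "u' \<in> hom C X Z'" "v' \<in> hom C Z' Y" "f = v' \<cdot> u'"
    using zero_arrowE[OF assms(1,2)] .
  have "Z' \<in> Obj C" "Y \<in> Obj C" "X \<in> Obj C"
    using homD z assms(2) by blast+
  then obtain t where t: "t \<in> hom C Z' Z"
    using zero_objectD(1)[OF assms(3)] by blast
  have "t \<cdot> u' = u"
    using zero_objectD(3)[OF assms(3) \<open>X \<in> Obj C\<close>] comp_hom[OF t z(2)] assms(4) by blast
  moreover have "v \<cdot> t = v'"
    using zero_objectD(4)[OF z(1) \<open>Y \<in> Obj C\<close>] comp_hom[OF assms(5) t] z(3) by blast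
  ultimately show ?thesis
    using hom_assoc[OF assms(5) t z(2)] z(4) by simp
qed

text \<open>Serves to prove equations between arrows by showing that both sides are zero.\<close>

lemma zero_arrow_unique:
  assumes "zero_arrow C f" "zero_arrow C g" "f \<in> hom C X Y" "g \<in> hom C X Y"
  shows "f = g"
proof -
  obtain Z u v where "zero_object C Z" "u \<in> hom C X Z" "v \<in> hom C Z Y" "g = v \<cdot> u"
    using zero_arrowE[OF assms(2,4)] .
  then show ?thesis using zero_arrow_factors[OF assms(1,3)] by simp
qed

section \<open>Kernels\<close>

lemma kernel_ex1_lift:
  assumes "is_kernel C f k" "f \<in> hom C X Y" "h \<in> hom C Q X" "zero_arrow C (f \<cdot> h)"
  shows "\<exists>!u. u \<in> hom C Q (Dom C k) \<and> k \<cdot> u = h"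
proof -
  have "\<forall>h\<in>Arr C. Cod C h = Dom C f \<and> zero_arrow C (f \<cdot> h) \<longrightarrow>
      (\<exists>!u. u \<in> hom C (Dom C h) (Dom C k) \<and> k \<cdot> u = h)"
    using assms(1) unfolding is_kernel_def by (elim conjE)
  from bspec[OF this, of h] show ?thesis
    using assms(4) homD[OF assms(2)] homD[OF assms(3)] by auto
qed

lemma kernelD:
  assumes "is_kernel C f k" "f \<in> hom C X Y"
  shows kernel_hom: "k \<in> hom C (Dom C k) X"
    and kernel_zero: "zero_arrow C (f \<cdot> k)"
    and kernel_lift: "\<And>Q h. \<lbrakk>h \<in> hom C Q X; zero_arrow C (f \<cdot> h)\<rbrakk> \<Longrightarrow> \<exists>u\<in>hom C Q (Dom C k). k \<cdot> u = h"
proof -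
  show "k \<in> hom C (Dom C k) X" "zero_arrow C (f \<cdot> k)"
    using assms unfolding is_kernel_def hom_def by auto
  fix Q h assume h: "h \<in> hom C Q X" "zero_arrow C (f \<cdot> h)"
  show "\<exists>u\<in>hom C Q (Dom C k). k \<cdot> u = h"
    using kernel_ex1_lift[OF assms h] by auto
qed

lemma kernel_monic:
  assumes "is_kernel C f k"
  shows "monic C k"
proof -
  have f: "f \<in> hom C (Dom C f) (Cod C f)"
    using assms Arr_hom unfolding is_kernel_def by simp
  note k = kernelD[OF assms f]
  show ?thesis
  proof (rule monicI[OF k(1)])
    fix Q g h assume gh: "g \<in> hom C Q (Dom C k)" "h \<in> hom C Q (Dom C k)" "k \<cdot> g = k \<cdot> h"
    have "zero_arrow C (f \<cdot> (k \<cdot> g))"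
      using zero_arrow_comp_right[OF k(2) comp_hom[OF f k(1)] gh(1)] hom_assoc[OF f k(1) gh(1)] by simp
    from kernel_ex1_lift[OF assms f comp_hom[OF k(1) gh(1)] this]
    show "g = h" using gh by auto
  qed
qed

text \<open>Monicity of \<open>k\<close> supplies the uniqueness of lifts, so only their existence
  is left to check.\<close>

lemma kernelI:
  assumes "f \<in> hom C X Y" "k \<in> hom C K X" "monic C k" "zero_arrow C (f \<cdot> k)"
    and "\<And>Q h. \<lbrakk>h \<in> hom C Q X; zero_arrow C (f \<cdot> h)\<rbrakk> \<Longrightarrow> \<exists>u\<in>hom C Q K. k \<cdot> u = h"
  shows "is_kernel C f k"
  unfolding is_kernel_def
proof (intro conjI ballI impI)
  have D: "Dom C f = X" "Dom C k = K" using homD assms(1,2) by blast+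
  show "f \<in> Arr C" "k \<in> Arr C" "Cod C k = Dom C f"
    using homD[OF assms(1)] homD[OF assms(2)] by auto
  show "zero_arrow C (f \<cdot> k)" by fact
  fix h assume "h \<in> Arr C" "Cod C h = Dom C f \<and> zero_arrow C (f \<cdot> h)"
  then obtain u where u: "u \<in> hom C (Dom C h) K" "k \<cdot> u = h"
    using assms(5)[of h "Dom C h"] Arr_hom[of h] D by auto
  show "\<exists>!u. u \<in> hom C (Dom C h) (Dom C k) \<and> k \<cdot> u = h"
  proof (rule ex1I[of _ u])
    show "u \<in> hom C (Dom C h) (Dom C k) \<and> k \<cdot> u = h" using u D by simp
    fix v assume "v \<in> hom C (Dom C h) (Dom C k) \<and> k \<cdot> v = h"
    then show "v = u" using monicD[OF assms(3,2) _ u(1), of v] u(2) D by auto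
  qed
qed

section \<open>Subobjects as equivalence classes of monomorphisms\<close>

lemma monic_Arr: "monic C m \<Longrightarrow> m \<in> Arr C"
  unfolding monic_def by (elim conjE)

lemma monics_intoD: "m \<in> monics_into C X \<Longrightarrow> monic C m \<and> m \<in> hom C (Dom C m) X"
  using monic_Arr by (auto simp: monics_into_def hom_def)

lemma factors_through_refl: "m \<in> Arr C \<Longrightarrow> factors_through C m m"
  unfolding factors_through_def
  by (rule bexI[of _ "Ident C (Dom C m)"]) (simp_all add: Comp_Ident Ident_hom Dom_closed)

lemma factors_through_trans:
  assumes "factors_through C l m" "factors_through C m n" "n \<in> Arr C"
  shows "factors_through C l n"
proof -
  obtain h k where hk: "h \<in> hom C (Dom C l) (Dom C m)" "l = m \<cdot> h"
      "k \<in> hom C (Dom C m) (Dom C n)" "m = n \<cdot> k"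
    using assms(1,2) unfolding factors_through_def by blast
  then have "l = n \<cdot> (k \<cdot> h)"
    using hom_assoc[OF _ hk(3,1), of n "Cod C n"] Arr_hom[OF assms(3)] by metis
  then show ?thesis
    unfolding factors_through_def using comp_hom[OF hk(3,1)] by blast
qed

lemma equiv_subobjects:
  "equiv (monics_into C X) {(m, n). m \<in> monics_into C X \<and> n \<in> monics_into C X \<and>
              factors_through C m n \<and> factors_through C n m}"
proof (rule equivI)
  have A: "m \<in> Arr C" if "m \<in> monics_into C X" for m
    using homD monics_intoD that by blast
  show "refl_on (monics_into C X) {(m, n). m \<in> monics_into C X \<and> n \<in> monics_into C X \<and>
              factors_through C m n \<and> factors_through C n m}"
    by (auto simp: refl_on_def intro: factors_through_refl A)
  show "sym {(m, n). m \<in> monics_into C X \<and> n \<in> monics_into C X \<and>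
              factors_through C m n \<and> factors_through C n m}"
    by (auto simp: sym_def)
  show "trans {(m, n). m \<in> monics_into C X \<and> n \<in> monics_into C X \<and>
              factors_through C m n \<and> factors_through C n m}"
    by (auto simp: trans_def intro: factors_through_trans A)
qed auto

lemma subobject_member:
  assumes "s \<in> subobjects C X" "m \<in> s"
  shows "m \<in> monics_into C X"
  using assms in_quotient_imp_subset[OF equiv_subobjects] unfolding subobjects_def by blast

lemma subobject_members_equivalent:
  assumes "s \<in> subobjects C X" "m \<in> s" "n \<in> s"
  shows "factors_through C m n"
  using assms quotient_eq_iff[OF equiv_subobjects] unfolding subobjects_def by blast

lemma subobject_eqI:
  assumes "s \<in> subobjects C X" "t \<in> subobjects C X" "m \<in> s" "n \<in> t"
    and "factors_through C m n" "factors_through C n m"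
  shows "s = t"
  using assms quotient_eq_iff[OF equiv_subobjects] subobject_member
  unfolding subobjects_def by fast

lemma subobject_le_antisym:
  assumes "s \<in> subobjects C X" "t \<in> subobjects C X"
    and "le (subobject_order C X) s t" "le (subobject_order C X) t s"
  shows "s = t"
proof -
  obtain m n n' m' where mn: "m \<in> s" "n \<in> t" "factors_through C m n"
      "m' \<in> s" "n' \<in> t" "factors_through C n' m'"
    using assms(3,4) unfolding subobject_order_def by auto
  have A: "m \<in> Arr C" "m' \<in> Arr C"
    using homD monics_intoD subobject_member assms(1) mn by blast+
  have "factors_through C n m"
    using factors_through_trans subobject_members_equivalent assms(1,2) mn A by meson
  then show ?thesis
    using subobject_eqI[OF assms(1,2) mn(1,2,3)] by blast
qed

lemma is_glb_subobject_unique: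
  assumes "is_glb (subobject_order C X) s A" "is_glb (subobject_order C X) t A"
  shows "s = t"
proof (rule subobject_le_antisym)
  show "s \<in> subobjects C X" "t \<in> subobjects C X"
    using assms unfolding greatest_def Lower_def by (auto simp: subobject_order_def)
  show "le (subobject_order C X) s t" "le (subobject_order C X) t s"
    using assms unfolding greatest_def by blast+
qed

text \<open>The operator \<Sqinter> picks some greatest lower bound by choice. Antisymmetry of the
  order on equivalence classes makes the choice unique.\<close>

lemma is_glb_subobject_inf:
  assumes "is_glb (subobject_order C X) s A"
  shows "s = \<Sqinter>\<^bsub>subobject_order C X\<^esub> A"
  unfolding inf_def
  using someI[of "\<lambda>x. is_glb (subobject_order C X) x A", OF assms] is_glb_subobject_unique[OF assms]
  by blast

text \<open>Two kernels of \<open>f\<close> lift through one another, and a monomorphism equivalent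
  to a kernel inherits its universal property. Hence \<open>Ker C f\<close> is precisely the class
  of the representative \<open>k\<close>.\<close>

lemma Ker_subobject:
  assumes "is_kernel C f k" "f \<in> hom C X Y"
  shows "Ker C f \<in> subobjects C X"
proof -
  note k = kernelD[OF assms]
  have km: "k \<in> monics_into C X"
    using kernel_monic[OF assms(1)] homD[OF k(1)] by (simp add: monics_into_def)
  have "Ker C f = {n. n \<in> monics_into C X \<and> factors_through C k n \<and> factors_through C n k}"
  proof (intro Set.set_eqI iffI)
    fix n assume "n \<in> Ker C f"
    then have n: "is_kernel C f n" by (simp add: Ker_def)
    note n' = kernelD[OF n assms(2)]
    have "n \<in> monics_into C X"
      using kernel_monic[OF n] homD[OF n'(1)] by (simp add: monics_into_def)
    moreover have "factors_through C k n" "factors_through C n k"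
      unfolding factors_through_def using n'(3)[OF k(1,2)] k(3)[OF n'(1,2)] by metis+
    ultimately show "n \<in> {n. n \<in> monics_into C X \<and> factors_through C k n \<and> factors_through C n k}"
      by simp
  next
    fix n assume "n \<in> {n. n \<in> monics_into C X \<and> factors_through C k n \<and> factors_through C n k}"
    then have n: "n \<in> monics_into C X" "factors_through C k n" "factors_through C n k" by auto
    obtain a b where ab: "a \<in> hom C (Dom C k) (Dom C n)" "k = n \<cdot> a"
        "b \<in> hom C (Dom C n) (Dom C k)" "n = k \<cdot> b"
      using n(2,3) unfolding factors_through_def by blast
    have nm: "monic C n" "n \<in> hom C (Dom C n) X" using monics_intoD[OF n(1)] by auto
    have "is_kernel C f n"
    proof (rule kernelI[OF assms(2) nm(2,1)])
      show "zero_arrow C (f \<cdot> n)"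
        using zero_arrow_comp_right[OF k(2) comp_hom[OF assms(2) k(1)] ab(3)]
          hom_assoc[OF assms(2) k(1) ab(3)] ab(4) by simp
      fix Q h assume "h \<in> hom C Q X" "zero_arrow C (f \<cdot> h)"
      then obtain u where u: "u \<in> hom C Q (Dom C k)" "k \<cdot> u = h"
        using k(3) by blast
      then have "n \<cdot> (a \<cdot> u) = h"
        using hom_assoc[OF nm(2) ab(1) u(1)] ab(2) by simp
      then show "\<exists>u\<in>hom C Q (Dom C n). n \<cdot> u = h"
        using comp_hom[OF ab(1) u(1)] by blast
    qed
    then show "n \<in> Ker C f" by (simp add: Ker_def)
  qed
  then show ?thesis
    unfolding subobjects_def using km by (auto simp: quotient_def intro!: bexI[of _ k])
qed

end


section \<open>Duality and abelian categories\<close>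

text \<open>Cokernels and epimorphisms are defined through \<open>op_cat\<close>. With these rules a
  fact about kernels can be read in the opposite category and simplified back to its dual.\<close>

lemma op_op_cat [simp]: "op_cat (op_cat C) = C"
  by (simp add: op_cat_def)

lemma op_cat_simps [simp]:
  "Obj (op_cat C) = Obj C" "Arr (op_cat C) = Arr C" "Dom (op_cat C) = Cod C"
  "Cod (op_cat C) = Dom C" "Ident (op_cat C) = Ident C" "g \<cdot>\<^bsub>op_cat C\<^esub> f = f \<cdot>\<^bsub>C\<^esub> g"
  by (simp_all add: op_cat_def)

lemma hom_op_cat [simp]: "hom (op_cat C) X Y = hom C Y X"
  by (auto simp: hom_def)

lemma (in category) category_op: "category (op_cat C)"
  by unfold_locales
    (auto simp: Dom_closed Cod_closed Ident_closed Dom_Ident Cod_Ident Comp_closed Dom_Comp Cod_Comp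
      Comp_Ident Ident_Comp Comp_assoc)

lemma zero_object_op [simp]: "zero_object (op_cat C) Z \<longleftrightarrow> zero_object C Z"
  by (auto simp: zero_object_def)

lemma zero_arrow_op [simp]: "zero_arrow (op_cat C) f \<longleftrightarrow> zero_arrow C f"
  by (auto simp: zero_arrow_def)

text \<open>Freyd's axioms form dual pairs, apart from the zero object, which is self-dual.\<close>

lemma (in abelian_category) abelian_category_op: "abelian_category (op_cat C)"
proof -
  interpret op: category "op_cat C" by (rule category_op)
  show ?thesis
  proof unfold_locales
    fix X Y assume XY: "X \<in> Obj (op_cat C)" "Y \<in> Obj (op_cat C)"
    show "\<exists>P \<pi>. is_product (op_cat C) UNIV (\<lambda>b. if b then X else Y) P \<pi>"
      using has_binary_coproducts XY by simp
    show "\<exists>P \<pi>. is_product (op_cat (op_cat C)) UNIV (\<lambda>b. if b then X else Y) P \<pi>"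
      using has_binary_products XY by simp
  next
    fix f assume f: "f \<in> Arr (op_cat C)"
    show "\<exists>k. is_kernel (op_cat C) f k"
      using has_cokernels f by (simp add: is_cokernel_def)
    show "\<exists>k. is_cokernel (op_cat C) f k"
      using has_kernels f by (simp add: is_cokernel_def)
  next
    fix f assume "monic (op_cat C) f"
    then show "\<exists>g. is_kernel (op_cat C) g f"
      using epic_is_cokernel by (simp add: is_cokernel_def epic_def)
  next
    fix f assume "epic (op_cat C) f"
    then show "\<exists>g. is_cokernel (op_cat C) g f"
      using monic_is_kernel by (simp add: is_cokernel_def epic_def)
  qed (simp add: has_zero_object)
qed

lemma (in category) zero_arrow_exists:
  assumes "zero_object C Z" "X \<in> Obj C" "Y \<in> Obj C"
  obtains f where "f \<in> hom C X Y" "zero_arrow C f"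
  using zero_objectD(1)[OF assms(1,2)] zero_objectD(2)[OF assms(1,3)] comp_hom
    zero_arrowI[OF assms(1)] by meson

section \<open>Products\<close>

lemma (in category) productD:
  assumes "is_product C I X P \<pi>"
  shows product_proj: "i \<in> I \<Longrightarrow> \<pi> i \<in> hom C P (X i)"
    and product_lift_ex1: "\<lbrakk>Q \<in> Obj C; \<And>i. i \<in> I \<Longrightarrow> q i \<in> hom C Q (X i)\<rbrakk> \<Longrightarrow>
      \<exists>!h. h \<in> hom C Q P \<and> (\<forall>i\<in>I. \<pi> i \<cdot> h = q i)"
proof -
  have *: "\<forall>i\<in>I. \<pi> i \<in> hom C P (X i)"
    using assms unfolding is_product_def by (elim conjE)
  have **: "\<forall>Q\<in>Obj C. \<forall>q. (\<forall>i\<in>I. q i \<in> hom C Q (X i)) \<longrightarrow>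
        (\<exists>!h. h \<in> hom C Q P \<and> (\<forall>i\<in>I. \<pi> i \<cdot> h = q i))"
    using assms unfolding is_product_def by (elim conjE)
  show "i \<in> I \<Longrightarrow> \<pi> i \<in> hom C P (X i)"
    using * by (rule bspec)
  show "\<exists>!h. h \<in> hom C Q P \<and> (\<forall>i\<in>I. \<pi> i \<cdot> h = q i)"
    if "Q \<in> Obj C" "\<And>i. i \<in> I \<Longrightarrow> q i \<in> hom C Q (X i)"
    using that by (intro **[rule_format]) auto
qed

lemma (in category) product_eqI:
  assumes "is_product C I X P \<pi>" "g \<in> hom C Q P" "h \<in> hom C Q P"
    and "\<And>i. i \<in> I \<Longrightarrow> \<pi> i \<cdot> g = \<pi> i \<cdot> h"
  shows "g = h"
proof -
  have "\<exists>!u. u \<in> hom C Q P \<and> (\<forall>i\<in>I. \<pi> i \<cdot> u = \<pi> i \<cdot> h)"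
    using homD[OF assms(2)] comp_hom[OF product_proj[OF assms(1)] assms(3)]
    by (intro product_lift_ex1[OF assms(1)]) auto
  then show ?thesis
    using assms(2,3,4) by (elim ex1E) (metis (no_types, lifting))
qed

context abelian_category
begin

text \<open>The equaliser of \<open>x\<close> and \<open>y\<close> is the intersection of their graphs; a graph is a split
  monomorphism, hence a kernel.\<close>

lemma equalizer:
  assumes x: "x \<in> hom C X Y" and y: "y \<in> hom C X Y"
  obtains E e where "e \<in> hom C E X" "monic C e" "x \<cdot> e = y \<cdot> e"
    "\<And>Q h. \<lbrakk>h \<in> hom C Q X; x \<cdot> h = y \<cdot> h\<rbrakk> \<Longrightarrow> \<exists>u\<in>hom C Q E. e \<cdot> u = h"
proof -
  have XY: "X \<in> Obj C" "Y \<in> Obj C" using homD[OF x] by auto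
  obtain P \<pi> where P: "is_product C UNIV (\<lambda>b::bool. if b then X else Y) P \<pi>"
    using has_binary_products[OF XY] by blast
  have \<pi>: "\<pi> True \<in> hom C P X" "\<pi> False \<in> hom C P Y"
    using product_proj[OF P, of True] product_proj[OF P, of False] by auto
  \<comment> \<open>The graph of \<open>z\<close> is the arrow with coordinates identity and
    \<open>z\<close>. Its first coordinate makes it split.\<close>
  have graph: "\<exists>a\<in>hom C X P. \<pi> True \<cdot> a = Ident C X \<and> \<pi> False \<cdot> a = z"
    if z: "z \<in> hom C X Y" for z
  proof -
    have "\<exists>!h. h \<in> hom C X P \<and> (\<forall>i\<in>UNIV. \<pi> i \<cdot> h = (if i then Ident C X else z))"
      using z Ident_hom[OF XY(1)] XY by (intro product_lift_ex1[OF P]) auto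
    then obtain h where "h \<in> hom C X P" "\<forall>i. \<pi> i \<cdot> h = (if i then Ident C X else z)"
      by auto
    then show ?thesis by (intro bexI[of _ h]) simp_all
  qed
  obtain a where a: "a \<in> hom C X P" "\<pi> True \<cdot> a = Ident C X" "\<pi> False \<cdot> a = x"
    using graph[OF x] by blast
  obtain b where b: "b \<in> hom C X P" "\<pi> True \<cdot> b = Ident C X" "\<pi> False \<cdot> b = y"
    using graph[OF y] by blast
  obtain f where f: "is_kernel C f a"
    using monic_is_kernel[OF split_monic[OF a(1) \<pi>(1) a(2)]] by blast
  have fP: "f \<in> hom C P (Cod C f)"
    using f homD[OF a(1)] Arr_hom[of f] unfolding is_kernel_def by simp
  have fb: "f \<cdot> b \<in> hom C X (Cod C f)" using comp_hom[OF fP b(1)] .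
  \<comment> \<open>As \<open>a\<close> is the kernel of \<open>f\<close>, the kernel of
    \<open>f \<cdot> b\<close> is the pullback of the graph \<open>a\<close> along the graph
    \<open>b\<close>, that is, their intersection regarded as a subobject of
    \<open>X\<close>.\<close>
  obtain e where e: "is_kernel C (f \<cdot> b) e"
    using has_kernels homD[OF fb] by blast
  note e' = kernelD[OF e fb]
  have \<pi>_graph: "\<pi> True \<cdot> (c \<cdot> h) = h" "\<pi> False \<cdot> (c \<cdot> h) = z \<cdot> h"
    if "c \<in> hom C X P" "\<pi> True \<cdot> c = Ident C X" "\<pi> False \<cdot> c = z" "h \<in> hom C Q X" for c h z Q
    using hom_assoc[OF \<pi>(1) that(1,4)] hom_assoc[OF \<pi>(2) that(1,4)] that(2,3)
      hom_Ident_left[OF that(4)] by simp_all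
  have aD: "Dom C a = X" using homD[OF a(1)] by simp
  have "zero_arrow C (f \<cdot> (b \<cdot> e))"
    using e'(2) hom_assoc[OF fP b(1) e'(1)] by simp
  then obtain u where u: "u \<in> hom C (Dom C e) X" "a \<cdot> u = b \<cdot> e"
    using kernel_lift[OF f fP comp_hom[OF b(1) e'(1)]] aD by auto
  \<comment> \<open>Both graphs have the identity as first coordinate, so projecting
    \<open>a \<cdot> u = b \<cdot> e\<close> to \<open>X\<close> identifies \<open>u\<close> with
    \<open>e\<close>. Projecting to \<open>Y\<close> then gives the equation wanted.\<close>
  have "u = e" using \<pi>_graph(1)[OF a u(1)] \<pi>_graph(1)[OF b e'(1)] u(2) by simp
  then have eq: "x \<cdot> e = y \<cdot> e"
    using \<pi>_graph(2)[OF a u(1)] \<pi>_graph(2)[OF b e'(1)] u(2) by simp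
  show thesis
  proof (rule that[OF e'(1) kernel_monic[OF e] eq])
    fix Q h assume h: "h \<in> hom C Q X" "x \<cdot> h = y \<cdot> h"
    have "a \<cdot> h = b \<cdot> h"
    proof (rule product_eqI[OF P comp_hom[OF a(1) h(1)] comp_hom[OF b(1) h(1)]])
      fix i show "\<pi> i \<cdot> (a \<cdot> h) = \<pi> i \<cdot> (b \<cdot> h)"
        using \<pi>_graph[OF a h(1)] \<pi>_graph[OF b h(1)] h(2) by (cases i) simp_all
    qed
    then have "(f \<cdot> b) \<cdot> h = (f \<cdot> a) \<cdot> h"
      using hom_assoc[OF fP b(1) h(1)] hom_assoc[OF fP a(1) h(1)] by simp
    moreover have "zero_arrow C ((f \<cdot> a) \<cdot> h)"
      using zero_arrow_comp_right[OF kernel_zero[OF f fP] comp_hom[OF fP a(1)] h(1)] .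
    ultimately show "\<exists>u\<in>hom C Q (Dom C e). e \<cdot> u = h"
      using e'(3)[OF h(1)] by simp
  qed
qed

lemma coequalizer:
  assumes "x \<in> hom C X Y" "y \<in> hom C X Y"
  obtains E e where "e \<in> hom C Y E" "epic C e" "e \<cdot> x = e \<cdot> y"
    "\<And>Q h. \<lbrakk>h \<in> hom C Y Q; h \<cdot> x = h \<cdot> y\<rbrakk> \<Longrightarrow> \<exists>u\<in>hom C E Q. u \<cdot> e = h"
proof -
  interpret op: abelian_category "op_cat C" by (rule abelian_category_op)
  show thesis
  proof (rule op.equalizer[of x Y X y])
    show "x \<in> hom (op_cat C) Y X" "y \<in> hom (op_cat C) Y X" using assms by simp_all
    fix E e
    assume "e \<in> hom (op_cat C) E Y" "monic (op_cat C) e" "x \<cdot>\<^bsub>op_cat C\<^esub> e = y \<cdot>\<^bsub>op_cat C\<^esub> e"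
      and "\<And>Q h. \<lbrakk>h \<in> hom (op_cat C) Q Y; x \<cdot>\<^bsub>op_cat C\<^esub> h = y \<cdot>\<^bsub>op_cat C\<^esub> h\<rbrakk>
        \<Longrightarrow> \<exists>u\<in>hom (op_cat C) Q E. e \<cdot>\<^bsub>op_cat C\<^esub> u = h"
    then show thesis by (intro that) (simp_all add: epic_def)
  qed
qed

text \<open>If \<open>f x = f y\<close>, then \<open>f\<close> factors through the coequaliser \<open>e\<close> of \<open>x\<close> and \<open>y\<close>. The
  epimorphism \<open>e\<close> is the cokernel of some \<open>h\<close>, which \<open>f\<close> annihilates; so \<open>h\<close> is zero
  and \<open>e\<close> is split.\<close>

lemma monic_if_kernel_zero:
  assumes f: "f \<in> hom C X Y" and k: "is_kernel C f k" and k0: "zero_arrow C k"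
  shows "monic C f"
proof (rule monicI[OF f])
  fix Q x y assume x: "x \<in> hom C Q X" and y: "y \<in> hom C Q X" and xy: "f \<cdot> x = f \<cdot> y"
  note k' = kernelD[OF k f]
  interpret op: category "op_cat C" by (rule category_op)
  obtain E e where e: "e \<in> hom C X E" "epic C e" "e \<cdot> x = e \<cdot> y"
      "\<And>R h. \<lbrakk>h \<in> hom C X R; h \<cdot> x = h \<cdot> y\<rbrakk> \<Longrightarrow> \<exists>u\<in>hom C E R. u \<cdot> e = h"
    by (rule coequalizer[OF x y], rule that)
  obtain g where g: "g \<in> hom C E Y" "g \<cdot> e = f"
    using e(4)[OF f xy] by blast
  obtain h where h: "is_kernel (op_cat C) h e"
    using epic_is_cokernel[OF e(2)] unfolding is_cokernel_def by blast
  have hX: "h \<in> hom C (Dom C h) X"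
    using h homD[OF e(1)] Arr_hom[of h] unfolding is_kernel_def by simp
  have hX': "h \<in> hom (op_cat C) X (Dom C h)" using hX by simp
  note e' = op.kernelD[OF h hX']
  have "zero_arrow C (g \<cdot> (e \<cdot> h))"
    using zero_arrow_comp_left[OF _ comp_hom[OF e(1) hX] g(1)] e'(2) by simp
  then have "zero_arrow C (f \<cdot> h)"
    using hom_assoc[OF g(1) e(1) hX] g(2) by simp
  \<comment> \<open>This is where the assumption on the kernel enters: \<open>h\<close> lifts to the
    kernel \<open>k\<close>, and \<open>k\<close> is zero.\<close>
  then obtain u where u: "u \<in> hom C (Dom C h) (Dom C k)" "k \<cdot> u = h"
    using k'(3)[OF hX] by blast
  have h0: "zero_arrow C h"
    using zero_arrow_comp_right[OF k0 k'(1) u(1)] u(2) by simp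
  have XO: "X \<in> Obj C" using homD[OF f] by simp
  \<comment> \<open>Since \<open>h\<close> is zero, even the identity annihilates it and so factors
    through the cokernel \<open>e\<close> of \<open>h\<close>. The factor \<open>r\<close> is a
    retraction of \<open>e\<close>, which lets \<open>e\<close> be cancelled from
    \<open>e \<cdot> x = e \<cdot> y\<close>.\<close>
  have "zero_arrow C (Ident C X \<cdot> h)"
    using h0 hom_Ident_left[OF hX] by simp
  then obtain r where r: "r \<in> hom C E X" "r \<cdot> e = Ident C X"
    using e'(3)[of "Ident C X" X] Ident_hom[OF XO] homD[OF e(1)] by auto
  have "monic C e" using split_monic[OF e(1) r] .
  then show "x = y" using monicD[OF _ e(1) x y e(3)] by blast
qed

text \<open>The monomorphism \<open>m\<close> is the kernel of some \<open>f\<close>. As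
  \<open>f\<close> annihilates \<open>m\<close>, it factors through \<open>c\<close>, so whatever
  \<open>c\<close> annihilates is annihilated by \<open>f\<close> and lifts along
  \<open>m\<close>.\<close>

lemma kernel_of_cokernel:
  assumes m: "monic C m" "m \<in> hom C X Y" and c: "is_cokernel C m c"
  shows "c \<in> hom C Y (Cod C c)" "is_kernel C c m"
proof -
  interpret op: category "op_cat C" by (rule category_op)
  have mop: "m \<in> hom (op_cat C) Y X" using m(2) by simp
  note c' = op.kernelD[OF c[unfolded is_cokernel_def] mop]
  show cY: "c \<in> hom C Y (Cod C c)" using c'(1) by simp
  obtain f where f: "is_kernel C f m" using monic_is_kernel[OF m(1)] by blast
  have fY: "f \<in> hom C Y (Cod C f)"
    using f homD[OF m(2)] Arr_hom[of f] unfolding is_kernel_def by simp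
  note m' = kernelD[OF f fY]
  obtain v where v: "v \<in> hom C (Cod C c) (Cod C f)" "v \<cdot> c = f"
    using c'(3)[of f "Cod C f"] fY m'(2) by auto
  show "is_kernel C c m"
  proof (rule kernelI[OF cY m(2,1)])
    show "zero_arrow C (c \<cdot> m)" using c'(2) by simp
    fix Q h assume h: "h \<in> hom C Q Y" "zero_arrow C (c \<cdot> h)"
    have "zero_arrow C (f \<cdot> h)"
      using zero_arrow_comp_left[OF h(2) comp_hom[OF cY h(1)] v(1)] hom_assoc[OF v(1) cY h(1)] v(2)
      by simp
    then show "\<exists>u\<in>hom C Q X. m \<cdot> u = h"
      using m'(3)[OF h(1)] homD[OF m(2)] by simp
  qed
qed

end


section \<open>Functor categories\<close>

lemma functorI:
  assumes "category C"
    and "fobj F \<in> extensional (Obj C)" "farr F \<in> extensional (Arr C)"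
    and "\<And>X. X \<in> Obj C \<Longrightarrow> fobj F X \<in> Obj D"
    and arr: "\<And>X Y f. f \<in> hom C X Y \<Longrightarrow> farr F f \<in> hom D (fobj F X) (fobj F Y)"
    and "\<And>X. X \<in> Obj C \<Longrightarrow> farr F (Ident C X) = Ident D (fobj F X)"
    and comp: "\<And>X Y Z g f. \<lbrakk>g \<in> hom C Y Z; f \<in> hom C X Y\<rbrakk> \<Longrightarrow> farr F (g \<cdot>\<^bsub>C\<^esub> f) = farr F g \<cdot>\<^bsub>D\<^esub> farr F f"
  shows "is_functor C D F"
proof -
  interpret category C by fact
  have "farr F f \<in> hom D (fobj F (Dom C f)) (fobj F (Cod C f))" if "f \<in> Arr C" for f
    using arr[OF Arr_hom[OF that]] .
  moreover have "farr F (g \<cdot>\<^bsub>C\<^esub> f) = farr F g \<cdot>\<^bsub>D\<^esub> farr F f"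
    if "g \<in> Arr C" "f \<in> Arr C" "Dom C g = Cod C f" for f g
    using comp[of g "Cod C f" "Cod C g" f "Dom C f"] Arr_hom that by metis
  ultimately show ?thesis
    using assms(2-4,6) unfolding is_functor_def by (auto simp: PiE_def hom_def)
qed

lemma (in category) is_functor_id_functor: "is_functor C C (id_functor C)"
proof (rule functorI[OF category_axioms])
  fix X Y Z g f assume gf: "g \<in> hom C Y Z" "f \<in> hom C X Y"
  show "farr (id_functor C) (g \<cdot> f) = farr (id_functor C) g \<cdot> farr (id_functor C) f"
    using homD[OF gf(1)] homD[OF gf(2)] homD[OF comp_hom[OF gf]] by (simp add: id_functor_def)
next
  fix X Y f assume f: "f \<in> hom C X Y"
  show "farr (id_functor C) f \<in> hom C (fobj (id_functor C) X) (fobj (id_functor C) Y)"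
    using homD[OF f] f by (simp add: id_functor_def)
qed (simp_all add: id_functor_def Ident_closed)

locale functor_category = C: category C + D: category D
  for C :: "('o, 'm) cat" and D :: "('p, 'n) cat"
begin

lemma functorD:
  assumes "is_functor C D F"
  shows functor_obj: "X \<in> Obj C \<Longrightarrow> fobj F X \<in> Obj D"
    and functor_arr: "f \<in> hom C X Y \<Longrightarrow> farr F f \<in> hom D (fobj F X) (fobj F Y)"
    and functor_Ident: "X \<in> Obj C \<Longrightarrow> farr F (Ident C X) = Ident D (fobj F X)"
    and functor_comp: "\<lbrakk>g \<in> hom C Y Z; f \<in> hom C X Y\<rbrakk> \<Longrightarrow> farr F (g \<cdot>\<^bsub>C\<^esub> f) = farr F g \<cdot>\<^bsub>D\<^esub> farr F f"
  using assms unfolding is_functor_def hom_def by auto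

lemma hom_functor_cat:
  "\<eta> \<in> hom (functor_cat C D) F G \<longleftrightarrow> is_nat_trans C D \<eta> \<and> nt_dom \<eta> = F \<and> nt_cod \<eta> = G"
  by (simp add: hom_def functor_cat_def)

lemma Obj_functor_cat: "F \<in> Obj (functor_cat C D) \<longleftrightarrow> is_functor C D F"
  by (simp add: functor_cat_def)

lemma Comp_functor_cat: "\<eta> \<cdot>\<^bsub>functor_cat C D\<^esub> \<theta> = \<lparr>nt_dom = nt_dom \<theta>, nt_cod = nt_cod \<eta>,
    component = (\<lambda>X\<in>Obj C. component \<eta> X \<cdot>\<^bsub>D\<^esub> component \<theta> X)\<rparr>"
  by (simp add: functor_cat_def)

lemma component_Comp [simp]:
  "X \<in> Obj C \<Longrightarrow> component (\<eta> \<cdot>\<^bsub>functor_cat C D\<^esub> \<theta>) X = component \<eta> X \<cdot>\<^bsub>D\<^esub> component \<theta> X"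
  by (simp add: Comp_functor_cat)

lemma nat_transD:
  assumes "\<eta> \<in> hom (functor_cat C D) F G"
  shows nat_trans_dom: "is_functor C D F"
    and nat_trans_cod: "is_functor C D G"
    and component_ext: "component \<eta> \<in> extensional (Obj C)"
    and component_hom: "X \<in> Obj C \<Longrightarrow> component \<eta> X \<in> hom D (fobj F X) (fobj G X)"
    and naturality: "f \<in> hom C X Y \<Longrightarrow>
      component \<eta> Y \<cdot>\<^bsub>D\<^esub> farr F f = farr G f \<cdot>\<^bsub>D\<^esub> component \<eta> X"
  using assms C.homD[of f X Y] unfolding hom_functor_cat is_nat_trans_def by auto

lemma nat_transI:
  assumes "is_functor C D F" "is_functor C D G" "c \<in> extensional (Obj C)"
    and "\<And>X. X \<in> Obj C \<Longrightarrow> c X \<in> hom D (fobj F X) (fobj G X)"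
    and "\<And>X Y f. f \<in> hom C X Y \<Longrightarrow> c Y \<cdot>\<^bsub>D\<^esub> farr F f = farr G f \<cdot>\<^bsub>D\<^esub> c X"
  shows "\<lparr>nt_dom = F, nt_cod = G, component = c\<rparr> \<in> hom (functor_cat C D) F G"
  using assms(1-4) assms(5)[OF C.Arr_hom] by (simp add: hom_functor_cat is_nat_trans_def)

text \<open>Components are extensional, so agreement on the objects of \<open>C\<close> already
  gives equality of the records.\<close>

lemma nat_trans_eqI:
  assumes "\<eta> \<in> hom (functor_cat C D) F G" "\<theta> \<in> hom (functor_cat C D) F G"
    and "\<And>X. X \<in> Obj C \<Longrightarrow> component \<eta> X = component \<theta> X"
  shows "\<eta> = \<theta>"
proof -
  have "component \<eta> = component \<theta>"
    using extensionalityI[OF component_ext[OF assms(1)] component_ext[OF assms(2)]] assms(3) .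
  then show ?thesis
    using assms(1,2) by (auto simp: hom_functor_cat)
qed

lemma nat_trans_comp:
  assumes \<eta>: "\<eta> \<in> hom (functor_cat C D) G H" and \<theta>: "\<theta> \<in> hom (functor_cat C D) F G"
  shows "\<eta> \<cdot>\<^bsub>functor_cat C D\<^esub> \<theta> \<in> hom (functor_cat C D) F H"
proof -
  have "\<lparr>nt_dom = F, nt_cod = H, component = (\<lambda>X\<in>Obj C. component \<eta> X \<cdot>\<^bsub>D\<^esub> component \<theta> X)\<rparr>
    \<in> hom (functor_cat C D) F H"
  proof (rule nat_transI[OF nat_trans_dom[OF \<theta>] nat_trans_cod[OF \<eta>]])
    fix X Y f assume f: "f \<in> hom C X Y"
    then have XY: "X \<in> Obj C" "Y \<in> Obj C" using C.homD by blast+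
    note e = component_hom[OF \<eta>] and t = component_hom[OF \<theta>]
    have "(component \<eta> Y \<cdot>\<^bsub>D\<^esub> component \<theta> Y) \<cdot>\<^bsub>D\<^esub> farr F f
        = component \<eta> Y \<cdot>\<^bsub>D\<^esub> (farr G f \<cdot>\<^bsub>D\<^esub> component \<theta> X)"
      using D.hom_assoc[OF e[OF XY(2)] t[OF XY(2)] functor_arr[OF nat_trans_dom[OF \<theta>] f]]
        naturality[OF \<theta> f] by simp
    also have "\<dots> = (farr H f \<cdot>\<^bsub>D\<^esub> component \<eta> X) \<cdot>\<^bsub>D\<^esub> component \<theta> X"
      using D.hom_assoc[OF e[OF XY(2)] functor_arr[OF nat_trans_cod[OF \<theta>] f] t[OF XY(1)]]
        naturality[OF \<eta> f] by simp
    also have "\<dots> = farr H f \<cdot>\<^bsub>D\<^esub> (component \<eta> X \<cdot>\<^bsub>D\<^esub> component \<theta> X)"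
      using D.hom_assoc[OF functor_arr[OF nat_trans_cod[OF \<eta>] f] e[OF XY(1)] t[OF XY(1)]] .
    finally show "(\<lambda>X\<in>Obj C. component \<eta> X \<cdot>\<^bsub>D\<^esub> component \<theta> X) Y \<cdot>\<^bsub>D\<^esub> farr F f
        = farr H f \<cdot>\<^bsub>D\<^esub> (\<lambda>X\<in>Obj C. component \<eta> X \<cdot>\<^bsub>D\<^esub> component \<theta> X) X"
      using XY by simp
  qed (auto intro: D.comp_hom component_hom[OF \<eta>] component_hom[OF \<theta>])
  then show ?thesis
    using \<eta> \<theta> by (simp add: Comp_functor_cat hom_functor_cat)
qed

lemma Ident_functor_cat:
  assumes F: "is_functor C D F"
  shows "Ident (functor_cat C D) F \<in> hom (functor_cat C D) F F"
proof -
  have "\<lparr>nt_dom = F, nt_cod = F, component = (\<lambda>X\<in>Obj C. Ident D (fobj F X))\<rparr>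
    \<in> hom (functor_cat C D) F F"
  proof (rule nat_transI[OF F F])
    fix X Y f assume f: "f \<in> hom C X Y"
    then show "(\<lambda>X\<in>Obj C. Ident D (fobj F X)) Y \<cdot>\<^bsub>D\<^esub> farr F f
        = farr F f \<cdot>\<^bsub>D\<^esub> (\<lambda>X\<in>Obj C. Ident D (fobj F X)) X"
      using C.homD[OF f] D.hom_Ident_left[OF functor_arr[OF F f]]
        D.hom_Ident_right[OF functor_arr[OF F f]] by simp
  qed (auto intro: D.Ident_hom functor_obj[OF F])
  then show ?thesis by (simp add: functor_cat_def)
qed

lemma component_Ident [simp]:
  "X \<in> Obj C \<Longrightarrow> component (Ident (functor_cat C D) F) X = Ident D (fobj F X)"
  by (simp add: functor_cat_def)

lemma Arr_functor_cat: "\<eta> \<in> Arr (functor_cat C D) \<Longrightarrow>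
    \<eta> \<in> hom (functor_cat C D) (Dom (functor_cat C D) \<eta>) (Cod (functor_cat C D) \<eta>)"
  by (simp add: hom_def)

text \<open>Each law holds in the components. No size condition on \<open>C\<close> enters, so the
  functor category of a large category is covered.\<close>

lemma category_functor_cat: "category (functor_cat C D)"
proof unfold_locales
  fix f assume f: "f \<in> Arr (functor_cat C D)"
  note f' = Arr_functor_cat[OF f]
  show "Dom (functor_cat C D) f \<in> Obj (functor_cat C D)" "Cod (functor_cat C D) f \<in> Obj (functor_cat C D)"
    using nat_trans_dom[OF f'] nat_trans_cod[OF f'] by (simp_all add: Obj_functor_cat)
  show "f \<cdot>\<^bsub>functor_cat C D\<^esub> Ident (functor_cat C D) (Dom (functor_cat C D) f) = f"
    by (rule nat_trans_eqI[OF nat_trans_comp[OF f' Ident_functor_cat[OF nat_trans_dom[OF f']]] f'])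
      (simp add: D.hom_Ident_right[OF component_hom[OF f']])
  show "Ident (functor_cat C D) (Cod (functor_cat C D) f) \<cdot>\<^bsub>functor_cat C D\<^esub> f = f"
    by (rule nat_trans_eqI[OF nat_trans_comp[OF Ident_functor_cat[OF nat_trans_cod[OF f']] f'] f'])
      (simp add: D.hom_Ident_left[OF component_hom[OF f']])
next
  fix F assume "F \<in> Obj (functor_cat C D)"
  then have "Ident (functor_cat C D) F \<in> hom (functor_cat C D) F F"
    using Ident_functor_cat by (simp add: Obj_functor_cat)
  then show "Ident (functor_cat C D) F \<in> Arr (functor_cat C D)"
    "Dom (functor_cat C D) (Ident (functor_cat C D) F) = F"
    "Cod (functor_cat C D) (Ident (functor_cat C D) F) = F"
    by (simp_all add: hom_def)
next
  fix g f assume "g \<in> Arr (functor_cat C D)" "f \<in> Arr (functor_cat C D)"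
    "Dom (functor_cat C D) g = Cod (functor_cat C D) f"
  then have "g \<cdot>\<^bsub>functor_cat C D\<^esub> f \<in> hom (functor_cat C D) (Dom (functor_cat C D) f) (Cod (functor_cat C D) g)"
    using nat_trans_comp Arr_functor_cat by metis
  then show "g \<cdot>\<^bsub>functor_cat C D\<^esub> f \<in> Arr (functor_cat C D)"
    "Dom (functor_cat C D) (g \<cdot>\<^bsub>functor_cat C D\<^esub> f) = Dom (functor_cat C D) f"
    "Cod (functor_cat C D) (g \<cdot>\<^bsub>functor_cat C D\<^esub> f) = Cod (functor_cat C D) g"
    by (simp_all add: hom_def)
next
  fix h g f assume A: "h \<in> Arr (functor_cat C D)" "g \<in> Arr (functor_cat C D)" "f \<in> Arr (functor_cat C D)"
    "Dom (functor_cat C D) h = Cod (functor_cat C D) g" "Dom (functor_cat C D) g = Cod (functor_cat C D) f"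
  note f = Arr_functor_cat[OF A(3)] and g = Arr_functor_cat[OF A(2), unfolded A(5)]
    and h = Arr_functor_cat[OF A(1), unfolded A(4)]
  show "h \<cdot>\<^bsub>functor_cat C D\<^esub> g \<cdot>\<^bsub>functor_cat C D\<^esub> f = h \<cdot>\<^bsub>functor_cat C D\<^esub> (g \<cdot>\<^bsub>functor_cat C D\<^esub> f)"
    by (rule nat_trans_eqI[OF nat_trans_comp[OF nat_trans_comp[OF h g] f]
          nat_trans_comp[OF h nat_trans_comp[OF g f]]])
      (simp add: D.hom_assoc[OF component_hom[OF h] component_hom[OF g] component_hom[OF f]])
qed

end

text \<open>Makes the earlier facts about zero arrows, kernels and subobjects available for natural
  transformations, under the prefix \<open>Fun\<close>.\<close>

sublocale functor_category \<subseteq> Fun: category "functor_cat C D"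
  by (rule category_functor_cat)

section \<open>Zero arrows, kernels and lifts computed pointwise\<close>

context functor_category
begin

text \<open>The constant functor at \<open>Z\<close> works: every naturality square involved starts
  or ends at \<open>Z\<close>, hence commutes by uniqueness.\<close>

lemma zero_object_functor_cat:
  assumes Z: "zero_object D Z"
  shows "zero_object (functor_cat C D) \<lparr>fobj = \<lambda>X\<in>Obj C. Z, farr = \<lambda>f\<in>Arr C. Ident D Z\<rparr>"
    (is "zero_object _ ?Z")
proof -
  have ZO: "Z \<in> Obj D" using Z unfolding zero_object_def by blast
  have Zf: "is_functor C D ?Z"
  proof (rule functorI[OF C.category_axioms])
    fix X Y f assume "f \<in> hom C X Y"
    then show "farr ?Z f \<in> hom D (fobj ?Z X) (fobj ?Z Y)"
      using C.homD D.Ident_hom[OF ZO] by auto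
  next
    fix X Y W g f assume "g \<in> hom C Y W" "f \<in> hom C X Y"
    then show "farr ?Z (g \<cdot>\<^bsub>C\<^esub> f) = farr ?Z g \<cdot>\<^bsub>D\<^esub> farr ?Z f"
      using C.homD C.homD[OF C.comp_hom] D.hom_Ident_left[OF D.Ident_hom[OF ZO]] by auto
  qed (use ZO C.Ident_closed in auto)
  show ?thesis
    unfolding zero_object_def
  proof (intro conjI ballI)
    show "?Z \<in> Obj (functor_cat C D)" using Zf by (simp add: Obj_functor_cat)
  next
    fix F assume "F \<in> Obj (functor_cat C D)"
    then have F: "is_functor C D F" by (simp add: Obj_functor_cat)
    note FO = functor_obj[OF F]
    have "\<forall>X. \<exists>u. X \<in> Obj C \<longrightarrow> u \<in> hom D (fobj F X) Z"
      using D.zero_objectD(1)[OF Z FO] by blast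
    then obtain u where u: "\<And>X. X \<in> Obj C \<Longrightarrow> u X \<in> hom D (fobj F X) Z" by metis
    have "\<lparr>nt_dom = F, nt_cod = ?Z, component = restrict u (Obj C)\<rparr> \<in> hom (functor_cat C D) F ?Z"
    proof (rule nat_transI[OF F Zf])
      fix X Y f assume f: "f \<in> hom C X Y"
      note XY = C.homD[OF f]
      show "restrict u (Obj C) Y \<cdot>\<^bsub>D\<^esub> farr F f = farr ?Z f \<cdot>\<^bsub>D\<^esub> restrict u (Obj C) X"
        using XY u D.comp_hom[OF u functor_arr[OF F f]] D.comp_hom[OF D.Ident_hom[OF ZO] u]
        by (intro D.zero_objectD(3)[OF Z, of "fobj F X"]) (auto intro: FO)
    qed (use u in auto)
    moreover have "\<eta> = \<theta>"
      if "\<eta> \<in> hom (functor_cat C D) F ?Z" "\<theta> \<in> hom (functor_cat C D) F ?Z" for \<eta> \<theta>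
    proof (rule nat_trans_eqI[OF that])
      fix X assume X: "X \<in> Obj C"
      show "component \<eta> X = component \<theta> X"
        using component_hom[OF that(1) X] component_hom[OF that(2) X] X
        by (intro D.zero_objectD(3)[OF Z, of "fobj F X"]) (auto intro: FO)
    qed
    ultimately show "\<exists>!\<eta>. \<eta> \<in> hom (functor_cat C D) F ?Z" by blast
    have "\<forall>X. \<exists>u. X \<in> Obj C \<longrightarrow> u \<in> hom D Z (fobj F X)"
      using D.zero_objectD(2)[OF Z FO] by blast
    then obtain v where v: "\<And>X. X \<in> Obj C \<Longrightarrow> v X \<in> hom D Z (fobj F X)" by metis
    have "\<lparr>nt_dom = ?Z, nt_cod = F, component = restrict v (Obj C)\<rparr> \<in> hom (functor_cat C D) ?Z F"
    proof (rule nat_transI[OF Zf F])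
      fix X Y f assume f: "f \<in> hom C X Y"
      note XY = C.homD[OF f]
      show "restrict v (Obj C) Y \<cdot>\<^bsub>D\<^esub> farr ?Z f = farr F f \<cdot>\<^bsub>D\<^esub> restrict v (Obj C) X"
        using XY v D.comp_hom[OF functor_arr[OF F f] v] D.comp_hom[OF v D.Ident_hom[OF ZO]]
        by (intro D.zero_objectD(4)[OF Z, of "fobj F Y"]) (auto intro: FO)
    qed (use v in auto)
    moreover have "\<eta> = \<theta>"
      if "\<eta> \<in> hom (functor_cat C D) ?Z F" "\<theta> \<in> hom (functor_cat C D) ?Z F" for \<eta> \<theta>
    proof (rule nat_trans_eqI[OF that])
      fix X assume X: "X \<in> Obj C"
      show "component \<eta> X = component \<theta> X"
        using component_hom[OF that(1) X] component_hom[OF that(2) X] X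
        by (intro D.zero_objectD(4)[OF Z, of "fobj F X"]) (auto intro: FO)
    qed
    ultimately show "\<exists>!\<eta>. \<eta> \<in> hom (functor_cat C D) ?Z F" by blast
  qed
qed

text \<open>Both directions compare the transformation with the composite \<open>v \<cdot> u\<close>
  through the constant zero functor, which has zero components and is the unique zero arrow from
  \<open>F\<close> to \<open>G\<close>.\<close>

lemma zero_arrow_functor_cat:
  assumes Z: "zero_object D Z" and \<eta>: "\<eta> \<in> hom (functor_cat C D) F G"
  shows "zero_arrow (functor_cat C D) \<eta> \<longleftrightarrow> (\<forall>X\<in>Obj C. zero_arrow D (component \<eta> X))"
proof -
  let ?Z = "\<lparr>fobj = \<lambda>X\<in>Obj C. Z, farr = \<lambda>f\<in>Arr C. Ident D Z\<rparr>"
  note Zf = zero_object_functor_cat[OF Z]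
  have F: "F \<in> Obj (functor_cat C D)" and G: "G \<in> Obj (functor_cat C D)"
    using Fun.homD[OF \<eta>] by auto
  obtain u where u: "u \<in> hom (functor_cat C D) F ?Z"
    using Fun.zero_objectD(1)[OF Zf F] by blast
  obtain v where v: "v \<in> hom (functor_cat C D) ?Z G"
    using Fun.zero_objectD(2)[OF Zf G] by blast
  have vu: "zero_arrow D (component (v \<cdot>\<^bsub>functor_cat C D\<^esub> u) X)" if X: "X \<in> Obj C" for X
    using D.zero_arrowI[OF Z] component_hom[OF u X] component_hom[OF v X] X by simp
  have eq: "\<eta> = v \<cdot>\<^bsub>functor_cat C D\<^esub> u" if "\<forall>X\<in>Obj C. zero_arrow D (component \<eta> X)"
  proof (rule nat_trans_eqI[OF \<eta> Fun.comp_hom[OF v u]])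
    fix X assume X: "X \<in> Obj C"
    show "component \<eta> X = component (v \<cdot>\<^bsub>functor_cat C D\<^esub> u) X"
      using D.zero_arrow_unique[OF _ vu[OF X] component_hom[OF \<eta> X]
          component_hom[OF Fun.comp_hom[OF v u] X]] that X by blast
  qed
  show ?thesis
  proof
    assume "zero_arrow (functor_cat C D) \<eta>"
    then have "\<eta> = v \<cdot>\<^bsub>functor_cat C D\<^esub> u"
      using Fun.zero_arrow_factors[OF _ \<eta> Zf u v] by blast
    then show "\<forall>X\<in>Obj C. zero_arrow D (component \<eta> X)" using vu by blast
  next
    assume "\<forall>X\<in>Obj C. zero_arrow D (component \<eta> X)"
    then show "zero_arrow (functor_cat C D) \<eta>"
      using eq Fun.zero_arrowI[OF Zf u v] by simp
  qed
qed

text \<open>A family of monomorphisms that is stable under the action of \<open>F\<close> carries a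
  functor structure. The restricted arrows preserve identities and composites because these
  equations hold after composing with the monomorphisms.\<close>

lemma subfunctor:
  assumes F: "is_functor C D F"
    and m: "\<And>X. X \<in> Obj C \<Longrightarrow> m X \<in> hom D (K X) (fobj F X)" "\<And>X. X \<in> Obj C \<Longrightarrow> monic D (m X)"
    and restr: "\<And>X Y f. f \<in> hom C X Y \<Longrightarrow> \<exists>u\<in>hom D (K X) (K Y). m Y \<cdot>\<^bsub>D\<^esub> u = farr F f \<cdot>\<^bsub>D\<^esub> m X"
  obtains S \<kappa> where "\<kappa> \<in> hom (functor_cat C D) S F" "\<And>X. X \<in> Obj C \<Longrightarrow> component \<kappa> X = m X"
proof -
  \<comment> \<open>The choice is arbitrary in form only: \<open>m (Cod C f)\<close> is monic, so
    the restriction of \<open>farr F f\<close> is unique.\<close>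
  define r where "r f = (SOME u. u \<in> hom D (K (Dom C f)) (K (Cod C f)) \<and>
      m (Cod C f) \<cdot>\<^bsub>D\<^esub> u = farr F f \<cdot>\<^bsub>D\<^esub> m (Dom C f))" for f
  have r: "r f \<in> hom D (K X) (K Y)" "m Y \<cdot>\<^bsub>D\<^esub> r f = farr F f \<cdot>\<^bsub>D\<^esub> m X" if f: "f \<in> hom C X Y" for X Y f
  proof -
    have "\<exists>u. u \<in> hom D (K (Dom C f)) (K (Cod C f)) \<and>
      m (Cod C f) \<cdot>\<^bsub>D\<^esub> u = farr F f \<cdot>\<^bsub>D\<^esub> m (Dom C f)"
      using restr[OF f] C.homD[OF f] by auto
    from someI_ex[OF this] show "r f \<in> hom D (K X) (K Y)" "m Y \<cdot>\<^bsub>D\<^esub> r f = farr F f \<cdot>\<^bsub>D\<^esub> m X"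
      using C.homD[OF f] by (auto simp: r_def)
  qed
  have mO: "K X \<in> Obj D" if "X \<in> Obj C" for X
    using D.homD[OF m(1)[OF that]] by simp
  define S where "S = \<lparr>fobj = restrict K (Obj C), farr = restrict r (Arr C)\<rparr>"
  have S: "is_functor C D S"
  proof (rule functorI[OF C.category_axioms])
    fix X assume X: "X \<in> Obj C"
    then show "fobj S X \<in> Obj D" using mO by (simp add: S_def)
    note I = C.Ident_hom[OF X]
    have "r (Ident C X) = Ident D (K X)"
    proof (rule D.monicD[OF m(2)[OF X] m(1)[OF X] r(1)[OF I] D.Ident_hom[OF mO[OF X]]])
      show "m X \<cdot>\<^bsub>D\<^esub> r (Ident C X) = m X \<cdot>\<^bsub>D\<^esub> Ident D (K X)"
        using r(2)[OF I] functor_Ident[OF F X] D.hom_Ident_left[OF m(1)[OF X]]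
          D.hom_Ident_right[OF m(1)[OF X]] by simp
    qed
    then show "farr S (Ident C X) = Ident D (fobj S X)"
      using X C.Ident_closed by (simp add: S_def)
  next
    fix X Y f assume f: "f \<in> hom C X Y"
    show "farr S f \<in> hom D (fobj S X) (fobj S Y)"
      using r(1)[OF f] C.homD[OF f] by (simp add: S_def)
  next
    fix X Y W g f assume g: "g \<in> hom C Y W" and f: "f \<in> hom C X Y"
    note gf = C.comp_hom[OF g f]
    have X: "X \<in> Obj C" and W: "W \<in> Obj C" and Y: "Y \<in> Obj C"
      using C.homD[OF f] C.homD[OF g] by auto
    have "m W \<cdot>\<^bsub>D\<^esub> (r g \<cdot>\<^bsub>D\<^esub> r f) = (farr F g \<cdot>\<^bsub>D\<^esub> m Y) \<cdot>\<^bsub>D\<^esub> r f"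
      using D.hom_assoc[OF m(1)[OF W] r(1)[OF g] r(1)[OF f]] r(2)[OF g] by simp
    also have "\<dots> = farr F g \<cdot>\<^bsub>D\<^esub> (farr F f \<cdot>\<^bsub>D\<^esub> m X)"
      using D.hom_assoc[OF functor_arr[OF F g] m(1)[OF Y] r(1)[OF f]] r(2)[OF f] by simp
    also have "\<dots> = m W \<cdot>\<^bsub>D\<^esub> r (g \<cdot>\<^bsub>C\<^esub> f)"
      using D.hom_assoc[OF functor_arr[OF F g] functor_arr[OF F f] m(1)[OF X]]
        r(2)[OF gf] functor_comp[OF F g f] by simp
    finally have "r (g \<cdot>\<^bsub>C\<^esub> f) = r g \<cdot>\<^bsub>D\<^esub> r f"
      using D.monicD[OF m(2)[OF W] m(1)[OF W] D.comp_hom[OF r(1)[OF g] r(1)[OF f]] r(1)[OF gf]]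
      by simp
    then show "farr S (g \<cdot>\<^bsub>C\<^esub> f) = farr S g \<cdot>\<^bsub>D\<^esub> farr S f"
      using C.homD[OF f] C.homD[OF g] C.homD[OF gf] by (simp add: S_def)
  qed (simp_all add: S_def)
  have "\<lparr>nt_dom = S, nt_cod = F, component = restrict m (Obj C)\<rparr> \<in> hom (functor_cat C D) S F"
  proof (rule nat_transI[OF S F])
    fix X Y f assume f: "f \<in> hom C X Y"
    show "restrict m (Obj C) Y \<cdot>\<^bsub>D\<^esub> farr S f = farr F f \<cdot>\<^bsub>D\<^esub> restrict m (Obj C) X"
      using r(2)[OF f] C.homD[OF f] by (simp add: S_def)
  qed (use m(1) in \<open>auto simp: S_def\<close>)
  then show thesis by (rule that) simp
qed

text \<open>By naturality \<open>farr F f\<close> carries the kernel at \<open>X\<close> into the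
  kernel at \<open>Y\<close>, so \<open>subfunctor\<close> applies. The existence of kernels is a
  hypothesis here, which is discharged later both in \<open>D\<close> and in its opposite.\<close>

lemma pointwise_kernel:
  assumes ker: "\<And>f. f \<in> Arr D \<Longrightarrow> \<exists>k. is_kernel D f k"
    and \<eta>: "\<eta> \<in> hom (functor_cat C D) F G"
  obtains K \<kappa> where "\<kappa> \<in> hom (functor_cat C D) K F"
    "\<And>X. X \<in> Obj C \<Longrightarrow> is_kernel D (component \<eta> X) (component \<kappa> X)"
proof -
  note F = nat_trans_dom[OF \<eta>] and G = nat_trans_cod[OF \<eta>]
  have "\<forall>X. \<exists>k. X \<in> Obj C \<longrightarrow> is_kernel D (component \<eta> X) k"
    using ker D.homD[OF component_hom[OF \<eta>]] by blast
  then obtain m where m: "\<And>X. X \<in> Obj C \<Longrightarrow> is_kernel D (component \<eta> X) (m X)" by metis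
  note m' = D.kernelD[OF m component_hom[OF \<eta>]]
  have restr: "\<exists>u\<in>hom D (Dom D (m X)) (Dom D (m Y)). m Y \<cdot>\<^bsub>D\<^esub> u = farr F f \<cdot>\<^bsub>D\<^esub> m X"
    if f: "f \<in> hom C X Y" for X Y f
  proof -
    have X: "X \<in> Obj C" and Y: "Y \<in> Obj C" using C.homD[OF f] by auto
    note eX = component_hom[OF \<eta> X] and eY = component_hom[OF \<eta> Y]
      and Ff = functor_arr[OF F f] and Gf = functor_arr[OF G f]
    have "component \<eta> Y \<cdot>\<^bsub>D\<^esub> (farr F f \<cdot>\<^bsub>D\<^esub> m X) = farr G f \<cdot>\<^bsub>D\<^esub> (component \<eta> X \<cdot>\<^bsub>D\<^esub> m X)"
      using D.hom_assoc[OF eY Ff m'(1)[OF X X]] D.hom_assoc[OF Gf eX m'(1)[OF X X]]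
        naturality[OF \<eta> f] by simp
    moreover have "zero_arrow D (farr G f \<cdot>\<^bsub>D\<^esub> (component \<eta> X \<cdot>\<^bsub>D\<^esub> m X))"
      using D.zero_arrow_comp_left[OF m'(2)[OF X X] D.comp_hom[OF eX m'(1)[OF X X]] Gf] .
    ultimately show ?thesis
      using m'(3)[OF Y Y D.comp_hom[OF Ff m'(1)[OF X X]]] by simp
  qed
  show thesis
  proof (rule subfunctor[OF F m'(1) D.kernel_monic[OF m] restr])
    fix S \<kappa> assume "\<kappa> \<in> hom (functor_cat C D) S F" "\<And>X. X \<in> Obj C \<Longrightarrow> component \<kappa> X = m X"
    then show thesis using m by (intro that[of \<kappa> S]) simp_all
  qed
qed

text \<open>The elementary direction. The converse, \<open>monic_component\<close>, relies on
  kernels.\<close>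

lemma monic_functor_cat_if:
  assumes \<kappa>: "\<kappa> \<in> hom (functor_cat C D) K F"
    and mono: "\<And>X. X \<in> Obj C \<Longrightarrow> monic D (component \<kappa> X)"
  shows "monic (functor_cat C D) \<kappa>"
proof (rule Fun.monicI[OF \<kappa>])
  fix Q \<eta> \<theta> assume \<eta>: "\<eta> \<in> hom (functor_cat C D) Q K" and \<theta>: "\<theta> \<in> hom (functor_cat C D) Q K"
    and eq: "\<kappa> \<cdot>\<^bsub>functor_cat C D\<^esub> \<eta> = \<kappa> \<cdot>\<^bsub>functor_cat C D\<^esub> \<theta>"
  show "\<eta> = \<theta>"
  proof (rule nat_trans_eqI[OF \<eta> \<theta>])
    fix X assume X: "X \<in> Obj C"
    have "component \<kappa> X \<cdot>\<^bsub>D\<^esub> component \<eta> X = component \<kappa> X \<cdot>\<^bsub>D\<^esub> component \<theta> X"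
      using arg_cong[OF eq, of "\<lambda>\<eta>. component \<eta> X"] X by simp
    then show "component \<eta> X = component \<theta> X"
      by (rule D.monicD[OF mono[OF X] component_hom[OF \<kappa> X] component_hom[OF \<eta> X] component_hom[OF \<theta> X]])
  qed
qed

text \<open>Lifts chosen separately in each component are automatically natural: the two sides of a
  naturality square agree after composing with the monic component of
  \<open>\<kappa>\<close>.\<close>

lemma lift_along_pointwise_monic:
  assumes \<kappa>: "\<kappa> \<in> hom (functor_cat C D) K F" and \<sigma>: "\<sigma> \<in> hom (functor_cat C D) S F"
    and mono: "\<And>X. X \<in> Obj C \<Longrightarrow> monic D (component \<kappa> X)"
    and lift: "\<And>X. X \<in> Obj C \<Longrightarrow>
      \<exists>u\<in>hom D (fobj S X) (fobj K X). component \<kappa> X \<cdot>\<^bsub>D\<^esub> u = component \<sigma> X"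
  shows "\<exists>\<upsilon>\<in>hom (functor_cat C D) S K. \<kappa> \<cdot>\<^bsub>functor_cat C D\<^esub> \<upsilon> = \<sigma>"
proof -
  note S = nat_trans_dom[OF \<sigma>] and K = nat_trans_dom[OF \<kappa>] and F = nat_trans_cod[OF \<kappa>]
  have "\<forall>X. \<exists>u. X \<in> Obj C \<longrightarrow> u \<in> hom D (fobj S X) (fobj K X) \<and> component \<kappa> X \<cdot>\<^bsub>D\<^esub> u = component \<sigma> X"
    using lift by blast
  then obtain u where u: "\<And>X. X \<in> Obj C \<Longrightarrow> u X \<in> hom D (fobj S X) (fobj K X)"
      "\<And>X. X \<in> Obj C \<Longrightarrow> component \<kappa> X \<cdot>\<^bsub>D\<^esub> u X = component \<sigma> X"
    by metis
  let ?u = "\<lparr>nt_dom = S, nt_cod = K, component = restrict u (Obj C)\<rparr>"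
  have u': "?u \<in> hom (functor_cat C D) S K"
  proof (rule nat_transI[OF S K])
    fix X Y f assume f: "f \<in> hom C X Y"
    have X: "X \<in> Obj C" and Y: "Y \<in> Obj C" using C.homD[OF f] by auto
    note kX = component_hom[OF \<kappa> X] and kY = component_hom[OF \<kappa> Y]
      and Sf = functor_arr[OF S f] and Kf = functor_arr[OF K f] and Ff = functor_arr[OF F f]
    have "component \<kappa> Y \<cdot>\<^bsub>D\<^esub> (u Y \<cdot>\<^bsub>D\<^esub> farr S f) = farr F f \<cdot>\<^bsub>D\<^esub> (component \<kappa> X \<cdot>\<^bsub>D\<^esub> u X)"
      using D.hom_assoc[OF kY u(1)[OF Y] Sf] naturality[OF \<sigma> f] u(2)[OF X] u(2)[OF Y] by simp
    also have "\<dots> = component \<kappa> Y \<cdot>\<^bsub>D\<^esub> (farr K f \<cdot>\<^bsub>D\<^esub> u X)"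
      using D.hom_assoc[OF Ff kX u(1)[OF X]] D.hom_assoc[OF kY Kf u(1)[OF X]] naturality[OF \<kappa> f]
      by simp
    finally have "u Y \<cdot>\<^bsub>D\<^esub> farr S f = farr K f \<cdot>\<^bsub>D\<^esub> u X"
      by (rule D.monicD[OF mono[OF Y] kY D.comp_hom[OF u(1)[OF Y] Sf] D.comp_hom[OF Kf u(1)[OF X]]])
    then show "restrict u (Obj C) Y \<cdot>\<^bsub>D\<^esub> farr S f = farr K f \<cdot>\<^bsub>D\<^esub> restrict u (Obj C) X"
      using X Y by simp
  qed (use u(1) in auto)
  moreover have "\<kappa> \<cdot>\<^bsub>functor_cat C D\<^esub> ?u = \<sigma>"
    by (rule nat_trans_eqI[OF Fun.comp_hom[OF \<kappa> u'] \<sigma>]) (simp add: u(2))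
  ultimately show ?thesis by blast
qed

lemma kernel_functor_catI:
  assumes Z: "zero_object D Z"
    and \<eta>: "\<eta> \<in> hom (functor_cat C D) F G" and \<kappa>: "\<kappa> \<in> hom (functor_cat C D) K F"
    and ker: "\<And>X. X \<in> Obj C \<Longrightarrow> is_kernel D (component \<eta> X) (component \<kappa> X)"
  shows "is_kernel (functor_cat C D) \<eta> \<kappa>"
proof -
  note mono = D.kernel_monic[OF ker]
  note ker' = D.kernelD[OF ker component_hom[OF \<eta>]]
  show ?thesis
  proof (rule Fun.kernelI[OF \<eta> \<kappa> monic_functor_cat_if[OF \<kappa> mono]])
    show "zero_arrow (functor_cat C D) (\<eta> \<cdot>\<^bsub>functor_cat C D\<^esub> \<kappa>)"
      using zero_arrow_functor_cat[OF Z Fun.comp_hom[OF \<eta> \<kappa>]] ker'(2) by simp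
    fix S \<sigma> assume \<sigma>: "\<sigma> \<in> hom (functor_cat C D) S F"
      and 0: "zero_arrow (functor_cat C D) (\<eta> \<cdot>\<^bsub>functor_cat C D\<^esub> \<sigma>)"
    show "\<exists>\<upsilon>\<in>hom (functor_cat C D) S K. \<kappa> \<cdot>\<^bsub>functor_cat C D\<^esub> \<upsilon> = \<sigma>"
    proof (rule lift_along_pointwise_monic[OF \<kappa> \<sigma> mono])
      fix X assume X: "X \<in> Obj C"
      have "zero_arrow D (component \<eta> X \<cdot>\<^bsub>D\<^esub> component \<sigma> X)"
        using zero_arrow_functor_cat[OF Z Fun.comp_hom[OF \<eta> \<sigma>]] 0 X by simp
      then show "\<exists>u\<in>hom D (fobj S X) (fobj K X). component \<kappa> X \<cdot>\<^bsub>D\<^esub> u = component \<sigma> X"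
        using ker'(3)[OF X X component_hom[OF \<sigma> X]] D.homD[OF component_hom[OF \<kappa> X]] by simp
    qed
  qed
qed

end

section \<open>Passing to opposite categories, pointwise cokernels and monic components\<close>

lemma is_functor_op [simp]: "is_functor (op_cat C) (op_cat D) F \<longleftrightarrow> is_functor C D F"
  unfolding is_functor_def by auto

text \<open>A transformation records its source and target functor. Dualising keeps the components
  but reverses the direction, so the two fields must be swapped.\<close>

lemma hom_functor_cat_op:
  "\<eta> \<in> hom (functor_cat (op_cat C) (op_cat D)) F G \<longleftrightarrow>
    \<lparr>nt_dom = nt_cod \<eta>, nt_cod = nt_dom \<eta>, component = component \<eta>\<rparr> \<in> hom (functor_cat C D) G F"
  by (auto simp: hom_def functor_cat_def is_nat_trans_def)

locale abelian_functor_category = C: category C + D: abelian_category D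
  for C :: "('o, 'm) cat" and D :: "('p, 'n) cat"

sublocale abelian_functor_category \<subseteq> functor_category C D ..

context abelian_functor_category
begin

lemma functor_cat_kernel:
  assumes \<eta>: "\<eta> \<in> hom (functor_cat C D) F G"
  obtains K \<kappa> where "\<kappa> \<in> hom (functor_cat C D) K F" "is_kernel (functor_cat C D) \<eta> \<kappa>"
    "\<And>X. X \<in> Obj C \<Longrightarrow> is_kernel D (component \<eta> X) (component \<kappa> X)"
proof -
  obtain Z where Z: "zero_object D Z" using D.has_zero_object by blast
  show thesis
  proof (rule pointwise_kernel[OF D.has_kernels \<eta>])
    fix K \<kappa> assume "\<kappa> \<in> hom (functor_cat C D) K F"
      "\<And>X. X \<in> Obj C \<Longrightarrow> is_kernel D (component \<eta> X) (component \<kappa> X)"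
    then show thesis by (intro that kernel_functor_catI[OF Z \<eta>])
  qed
qed

text \<open>The pointwise kernel construction, read in the opposite categories. The conclusion
  concerns the components alone, and it is used in this form.\<close>

lemma pointwise_cokernel:
  assumes \<tau>: "\<tau> \<in> hom (functor_cat C D) F G"
  obtains Q c where "c \<in> hom (functor_cat C D) G Q"
    "\<And>X. X \<in> Obj C \<Longrightarrow> is_cokernel D (component \<tau> X) (component c X)"
proof -
  interpret opD: abelian_category "op_cat D" by (rule D.abelian_category_op)
  interpret op: functor_category "op_cat C" "op_cat D"
    by (rule functor_category.intro[OF C.category_op opD.category_axioms])
  let ?t = "\<lparr>nt_dom = nt_cod \<tau>, nt_cod = nt_dom \<tau>, component = component \<tau>\<rparr>"
  have t: "?t \<in> hom (functor_cat (op_cat C) (op_cat D)) G F"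
    using \<tau> by (cases \<tau>) (simp add: hom_functor_cat_op)
  show thesis
  proof (rule op.pointwise_kernel[OF opD.has_kernels t])
    fix Q c assume "c \<in> hom (functor_cat (op_cat C) (op_cat D)) Q G"
      "\<And>X. X \<in> Obj (op_cat C) \<Longrightarrow> is_kernel (op_cat D) (component ?t X) (component c X)"
    then show thesis
      by (intro that[of "\<lparr>nt_dom = nt_cod c, nt_cod = nt_dom c, component = component c\<rparr>" Q])
        (simp_all add: hom_functor_cat_op is_cokernel_def)
  qed
qed

text \<open>Monicity of \<open>\<tau>\<close> can be tested on natural transformations only, and two
  arrows into \<open>fobj F X\<close> need not be components of any. The kernel of
  \<open>component \<tau> X\<close> is one, since kernels are pointwise; cancelling
  \<open>\<tau>\<close> shows that it is zero.\<close>

lemma monic_component: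
  assumes \<tau>: "monic (functor_cat C D) \<tau>" "\<tau> \<in> hom (functor_cat C D) F G" and X: "X \<in> Obj C"
  shows "monic D (component \<tau> X)"
proof -
  obtain Z where Z: "zero_object D Z" using D.has_zero_object by blast
  obtain K \<kappa> where \<kappa>: "\<kappa> \<in> hom (functor_cat C D) K F" "is_kernel (functor_cat C D) \<tau> \<kappa>"
    "\<And>X. X \<in> Obj C \<Longrightarrow> is_kernel D (component \<tau> X) (component \<kappa> X)"
    by (rule functor_cat_kernel[OF \<tau>(2)], rule that)
  obtain \<zeta> where \<zeta>: "\<zeta> \<in> hom (functor_cat C D) K F" "zero_arrow (functor_cat C D) \<zeta>"
    using Fun.zero_arrow_exists[OF zero_object_functor_cat[OF Z]] Fun.homD[OF \<kappa>(1)] by blast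
  have "\<tau> \<cdot>\<^bsub>functor_cat C D\<^esub> \<kappa> = \<tau> \<cdot>\<^bsub>functor_cat C D\<^esub> \<zeta>"
    by (rule Fun.zero_arrow_unique[OF Fun.kernel_zero[OF \<kappa>(2) \<tau>(2)]
          Fun.zero_arrow_comp_left[OF \<zeta>(2,1) \<tau>(2)] Fun.comp_hom[OF \<tau>(2) \<kappa>(1)]
          Fun.comp_hom[OF \<tau>(2) \<zeta>(1)]])
  then have "\<kappa> = \<zeta>" by (rule Fun.monicD[OF \<tau> \<kappa>(1) \<zeta>(1)])
  then have "zero_arrow D (component \<kappa> X)"
    using zero_arrow_functor_cat[OF Z \<zeta>(1)] \<zeta>(2) X by blast
  then show ?thesis
    by (rule D.monic_if_kernel_zero[OF component_hom[OF \<tau>(2) X] \<kappa>(3)[OF X]])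
qed

text \<open>The pointwise cokernel \<open>c\<close> of \<open>\<tau>\<close> factors through \<open>\<tau>'\<close>, so whatever \<open>\<tau>'\<close>
  annihilates is annihilated by \<open>c\<close>.\<close>

lemma factors_through_if_cokernel_zero:
  assumes \<tau>: "monic (functor_cat C D) \<tau>" "\<tau> \<in> hom (functor_cat C D) F G"
    and \<tau>': "is_cokernel (functor_cat C D) \<tau> \<tau>'"
    and \<sigma>: "\<sigma> \<in> hom (functor_cat C D) S G"
    and 0: "\<And>X. X \<in> Obj C \<Longrightarrow> zero_arrow D (component \<tau>' X \<cdot>\<^bsub>D\<^esub> component \<sigma> X)"
  shows "factors_through (functor_cat C D) \<sigma> \<tau>"
proof -
  obtain Z where Z: "zero_object D Z" using D.has_zero_object by blast
  interpret opF: category "op_cat (functor_cat C D)" by (rule Fun.category_op)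
  obtain Q c where c: "c \<in> hom (functor_cat C D) G Q"
    "\<And>X. X \<in> Obj C \<Longrightarrow> is_cokernel D (component \<tau> X) (component c X)"
    by (rule pointwise_cokernel[OF \<tau>(2)], rule that)
  \<comment> \<open>Freyd's axiom on monomorphisms is applied in \<open>D\<close> at each object,
    which is possible because the components of \<open>\<tau>\<close> are monic.\<close>
  note ck = D.kernel_of_cokernel[OF monic_component[OF \<tau>] component_hom[OF \<tau>(2)] c(2)]
  have c\<tau>: "zero_arrow (functor_cat C D) (c \<cdot>\<^bsub>functor_cat C D\<^esub> \<tau>)"
    using zero_arrow_functor_cat[OF Z Fun.comp_hom[OF c(1) \<tau>(2)]]
      D.kernel_zero[OF ck(2) component_hom[OF c(1)]] by simp
  have \<tau>op: "\<tau> \<in> hom (op_cat (functor_cat C D)) G F" using \<tau>(2) by simp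
  note \<tau>'' = opF.kernelD[OF \<tau>'[unfolded is_cokernel_def] \<tau>op]
  obtain T where T: "\<tau>' \<in> hom (functor_cat C D) G T" using \<tau>''(1) by auto
  have "Cod (functor_cat C D) \<tau>' = T" using Fun.homD[OF T] by simp
  then obtain u where u: "u \<in> hom (functor_cat C D) T Q" "u \<cdot>\<^bsub>functor_cat C D\<^esub> \<tau>' = c"
    using \<tau>''(3)[of c Q] c(1) c\<tau> by auto
  have "\<exists>\<upsilon>\<in>hom (functor_cat C D) S F. \<tau> \<cdot>\<^bsub>functor_cat C D\<^esub> \<upsilon> = \<sigma>"
  proof (rule lift_along_pointwise_monic[OF \<tau>(2) \<sigma> monic_component[OF \<tau>]])
    fix X assume X: "X \<in> Obj C"
    note tX = component_hom[OF T X] and sX = component_hom[OF \<sigma> X] and uX = component_hom[OF u(1) X]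
    have "component c X = component u X \<cdot>\<^bsub>D\<^esub> component \<tau>' X"
      using u(2) X component_Comp[OF X, of u \<tau>'] by simp
    then have "zero_arrow D (component c X \<cdot>\<^bsub>D\<^esub> component \<sigma> X)"
      using D.zero_arrow_comp_left[OF 0[OF X] D.comp_hom[OF tX sX] uX] D.hom_assoc[OF uX tX sX]
      by simp
    then show "\<exists>u\<in>hom D (fobj S X) (fobj F X). component \<tau> X \<cdot>\<^bsub>D\<^esub> u = component \<sigma> X"
      using D.kernel_lift[OF ck(2)[OF X X X] component_hom[OF c(1) X] sX]
        D.homD[OF component_hom[OF \<tau>(2) X]] by simp
  qed
  then show ?thesis
    unfolding factors_through_def using Fun.homD[OF \<sigma>] Fun.homD[OF \<tau>(2)] by metis
qed

end


section \<open>Powers and omega preradicals\<close>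

text \<open>A power is a limit over a discrete category.\<close>

lemma powers_exist:
  fixes C :: "('o, 'm) cat" and I :: "'i set"
  assumes "category C" and complete: "complete_cat TYPE('u) C"
    and small: "small TYPE('u) I" and M: "M \<in> Obj C"
  shows "\<exists>P \<pi>. is_product C I (\<lambda>i. M) P \<pi>"
proof -
  interpret category C by fact
  \<comment> \<open>Completeness is stated for diagrams whose objects and arrows lie in
    \<open>'u\<close>, so the index set is first copied into \<open>'u\<close>.\<close>
  obtain g :: "'i \<Rightarrow> 'u" where g: "inj_on g I"
    using small unfolding small_def lesspoll_def lepoll_def by blast
  \<comment> \<open>All arrows are identities. Composable arrows coincide, so returning the first
    argument is a correct composition.\<close>
  define J where "J = \<lparr>Obj = g ` I, Arr = g ` I, Dom = id, Cod = id, Ident = id, Comp = \<lambda>x y. x\<rparr>"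
  define D where "D = \<lparr>fobj = (\<lambda>x\<in>g ` I. M), farr = (\<lambda>x\<in>g ` I. Ident C M)\<rparr>"
  have "g ` I \<prec> (UNIV :: 'u set)"
    using eq_lesspoll_trans[OF inj_on_image_eqpoll_self[OF g]] small unfolding small_def .
  then have "small TYPE('u) (Obj J)" "small TYPE('u) (Arr J)"
    by (simp_all add: small_def J_def)
  moreover have "category J" by unfold_locales (auto simp: J_def)
  moreover have "is_functor J C D"
    using M Ident_hom[OF M] hom_Ident_left[OF Ident_hom[OF M]]
    by (auto simp: is_functor_def J_def D_def hom_def)
  ultimately obtain P \<nu> where L: "is_limit J C D P \<nu>"
    using complete unfolding complete_cat_def by blast
  have cone: "is_cone J C D X \<mu> \<longleftrightarrow> X \<in> Obj C \<and> (\<forall>i\<in>I. \<mu> (g i) \<in> hom C X M)" for X \<mu>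
    using hom_Ident_left by (auto simp: is_cone_def J_def D_def)
  have P: "P \<in> Obj C" "\<forall>i\<in>I. \<nu> (g i) \<in> hom C P M"
    using L cone unfolding is_limit_def by blast+
  have "is_product C I (\<lambda>i. M) P (\<lambda>i. \<nu> (g i))"
    unfolding is_product_def
  proof (intro conjI P ballI allI impI)
    fix Q q assume Q: "Q \<in> Obj C" "\<forall>i\<in>I. q i \<in> hom C Q M"
    \<comment> \<open>The inverse of \<open>g\<close> on \<open>I\<close> transports the family
      \<open>q\<close> to the copied index set.\<close>
    have "is_cone J C D Q (\<lambda>x. q (inv_into I g x))"
      using Q g by (simp add: cone)
    then have "\<exists>!h. h \<in> hom C Q P \<and> (\<forall>j\<in>Obj J. \<nu> j \<cdot>\<^bsub>C\<^esub> h = q (inv_into I g j))"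
      using L unfolding is_limit_def by (elim conjE allE impE)
    then show "\<exists>!h. h \<in> hom C Q P \<and> (\<forall>i\<in>I. \<nu> (g i) \<cdot>\<^bsub>C\<^esub> h = q i)"
      using g by (simp add: J_def)
  qed
  then show ?thesis by blast
qed

text \<open>Records the form in which completeness and small Hom-sets are used: powers with exponent
  a Hom-set exist. Under this assumption the choice in \<open>power\<close> yields genuine
  products.\<close>

locale category_with_hom_powers = category C for C :: "('o, 'm) cat" (structure) +
  assumes hom_powers: "\<lbrakk>L \<in> Obj C; N \<in> Obj C; M \<in> Obj C\<rbrakk> \<Longrightarrow>
    \<exists>P \<pi>. is_product C (hom C L N) (\<lambda>i. M) P \<pi>"
begin

lemma power_is_product:
  assumes "L \<in> Obj C" "N \<in> Obj C" "M \<in> Obj C"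
  shows "is_product C (hom C L N) (\<lambda>i. M) (power_obj C M (hom C L N)) (power_proj C M (hom C L N))"
proof -
  have "\<exists>P\<pi>. is_product C (hom C L N) (\<lambda>i. M) (fst P\<pi>) (snd P\<pi>)"
    using hom_powers[OF assms] by auto
  from someI_ex[OF this] show ?thesis
    unfolding power_obj_def power_proj_def power_def .
qed

lemma power_obj_closed:
  assumes "L \<in> Obj C" "N \<in> Obj C" "M \<in> Obj C"
  shows "power_obj C M (hom C L N) \<in> Obj C"
  using power_is_product[OF assms] unfolding is_product_def by blast

lemma power_lift:
  assumes "L \<in> Obj C" "N \<in> Obj C" "M \<in> Obj C" "Q \<in> Obj C"
    and "\<And>f. f \<in> hom C L N \<Longrightarrow> q f \<in> hom C Q M"
  shows power_lift_hom: "power_lift C M (hom C L N) Q q \<in> hom C Q (power_obj C M (hom C L N))"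
    and power_proj_lift: "f \<in> hom C L N \<Longrightarrow>
      power_proj C M (hom C L N) f \<cdot> power_lift C M (hom C L N) Q q = q f"
proof -
  have "\<exists>!h. h \<in> hom C Q (power_obj C M (hom C L N)) \<and>
      (\<forall>f\<in>hom C L N. power_proj C M (hom C L N) f \<cdot> h = q f)"
    by (rule product_lift_ex1[OF power_is_product[OF assms(1-3)] assms(4,5)])
  from theI'[OF this]
  show "power_lift C M (hom C L N) Q q \<in> hom C Q (power_obj C M (hom C L N))"
    "f \<in> hom C L N \<Longrightarrow> power_proj C M (hom C L N) f \<cdot> power_lift C M (hom C L N) Q q = q f"
    unfolding power_lift_def by blast+
qed

lemma omega_functor_arr:
  assumes NM: "N \<in> Obj C" "M \<in> Obj C" and g: "g \<in> hom C X Y"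
  shows omega_functor_arr_hom: "farr (omega_functor C N M) g
      \<in> hom C (power_obj C M (hom C X N)) (power_obj C M (hom C Y N))"
    and omega_functor_arr_proj: "f \<in> hom C Y N \<Longrightarrow>
      power_proj C M (hom C Y N) f \<cdot> farr (omega_functor C N M) g = power_proj C M (hom C X N) (f \<cdot> g)"
proof -
  have X: "X \<in> Obj C" and Y: "Y \<in> Obj C" using homD[OF g] by auto
  have eq: "farr (omega_functor C N M) g = power_lift C M (hom C Y N) (power_obj C M (hom C X N))
      (\<lambda>f. power_proj C M (hom C X N) (f \<cdot> g))"
    using homD[OF g] by (simp add: omega_functor_def power_map_def)
  note lift = power_lift[OF Y NM power_obj_closed[OF X NM],
      of "\<lambda>f. power_proj C M (hom C X N) (f \<cdot> g)",
      OF product_proj[OF power_is_product[OF X NM] comp_hom[OF _ g]]]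
  show "farr (omega_functor C N M) g \<in> hom C (power_obj C M (hom C X N)) (power_obj C M (hom C Y N))"
    unfolding eq by (rule lift(1))
  show "power_proj C M (hom C Y N) f \<cdot> farr (omega_functor C N M) g = power_proj C M (hom C X N) (f \<cdot> g)"
    if "f \<in> hom C Y N"
    unfolding eq by (rule lift(2)[OF _ that])
qed

text \<open>Arrows into a power are compared coordinatewise. The action of an arrow \<open>g\<close>
  sends index \<open>f\<close> to \<open>f \<cdot> g\<close>, so the functor laws become the unit
  and associativity laws for these indices.\<close>

lemma is_functor_omega_functor:
  assumes NM: "N \<in> Obj C" "M \<in> Obj C"
  shows "is_functor C C (omega_functor C N M)" (is "is_functor C C ?W")
proof (rule functorI[OF category_axioms])
  have obj: "fobj ?W X = power_obj C M (hom C X N)" if "X \<in> Obj C" for X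
    using that by (simp add: omega_functor_def)
  note arr = omega_functor_arr_hom[OF NM] and proj = omega_functor_arr_proj[OF NM]
  show "fobj ?W \<in> extensional (Obj C)" "farr ?W \<in> extensional (Arr C)"
    by (simp_all add: omega_functor_def)
  show "fobj ?W X \<in> Obj C" if "X \<in> Obj C" for X
    using power_obj_closed[OF that NM] obj[OF that] by simp
  show "farr ?W f \<in> hom C (fobj ?W X) (fobj ?W Y)" if "f \<in> hom C X Y" for X Y f
    using arr[OF that] homD[OF that] obj by simp
  show "farr ?W (Ident C X) = Ident C (fobj ?W X)" if X: "X \<in> Obj C" for X
    unfolding obj[OF X]
  proof (rule product_eqI[OF power_is_product[OF X NM] arr[OF Ident_hom[OF X]]
        Ident_hom[OF power_obj_closed[OF X NM]]])
    fix f assume f: "f \<in> hom C X N"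
    show "power_proj C M (hom C X N) f \<cdot> farr ?W (Ident C X)
        = power_proj C M (hom C X N) f \<cdot> Ident C (power_obj C M (hom C X N))"
      using proj[OF Ident_hom[OF X] f] hom_Ident_right[OF f]
        hom_Ident_right[OF product_proj[OF power_is_product[OF X NM] f]] by simp
  qed
  show "farr ?W (h \<cdot> g) = farr ?W h \<cdot> farr ?W g" if h: "h \<in> hom C Y Z" and g: "g \<in> hom C X Y" for X Y Z h g
  proof -
    have Z: "Z \<in> Obj C" using homD[OF h] by simp
    show ?thesis
    proof (rule product_eqI[OF power_is_product[OF Z NM] arr[OF comp_hom[OF h g]]
          comp_hom[OF arr[OF h] arr[OF g]]])
      fix f assume f: "f \<in> hom C Z N"
      show "power_proj C M (hom C Z N) f \<cdot> farr ?W (h \<cdot> g)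
          = power_proj C M (hom C Z N) f \<cdot> (farr ?W h \<cdot> farr ?W g)"
        using proj[OF comp_hom[OF h g] f] proj[OF h f] proj[OF g comp_hom[OF f h]]
          hom_assoc[OF f h g] hom_assoc[OF product_proj[OF power_is_product[OF Z NM] f] arr[OF h] arr[OF g]]
        by simp
    qed
  qed
qed

lemma omega_trans_component:
  assumes k: "k \<in> hom C N M" and L: "L \<in> Obj C"
  shows omega_trans_component_hom: "component (omega_trans C k) L \<in> hom C L (power_obj C M (hom C L N))"
    and omega_trans_component_proj: "f \<in> hom C L N \<Longrightarrow>
      power_proj C M (hom C L N) f \<cdot> component (omega_trans C k) L = k \<cdot> f"
proof -
  have NM: "N \<in> Obj C" "M \<in> Obj C" using homD[OF k] by auto
  have eq: "component (omega_trans C k) L = power_lift C M (hom C L N) L (\<lambda>f. k \<cdot> f)"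
    using homD[OF k] L by (simp add: omega_trans_def)
  note lift = power_lift[OF L NM L, of "\<lambda>f. k \<cdot> f", OF comp_hom[OF k]]
  show "component (omega_trans C k) L \<in> hom C L (power_obj C M (hom C L N))"
    unfolding eq by (rule lift(1))
  show "power_proj C M (hom C L N) f \<cdot> component (omega_trans C k) L = k \<cdot> f" if "f \<in> hom C L N"
    unfolding eq by (rule lift(2)[OF _ that])
qed

text \<open>At coordinate \<open>f\<close> both sides of the naturality square for \<open>g\<close>
  reduce to \<open>k \<cdot> f \<cdot> g\<close>.\<close>

lemma omega_trans_hom:
  assumes k: "k \<in> hom C N M"
  shows "omega_trans C k \<in> hom (functor_cat C C) (id_functor C) (omega_functor C N M)"
proof -
  interpret functor_category C C ..
  have NM: "N \<in> Obj C" "M \<in> Obj C" using homD[OF k] by auto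
  note W = is_functor_omega_functor[OF NM]
  note hom = omega_trans_component_hom[OF k] and proj = omega_trans_component_proj[OF k]
  have "\<lparr>nt_dom = id_functor C, nt_cod = omega_functor C N M, component = component (omega_trans C k)\<rparr>
      \<in> hom (functor_cat C C) (id_functor C) (omega_functor C N M)"
  proof (rule nat_transI[OF is_functor_id_functor W])
    show "component (omega_trans C k) \<in> extensional (Obj C)"
      by (simp add: omega_trans_def)
    show "component (omega_trans C k) X
        \<in> hom C (fobj (id_functor C) X) (fobj (omega_functor C N M) X)" if "X \<in> Obj C" for X
      using hom[OF that] that by (simp add: id_functor_def omega_functor_def)
    fix X Y g assume g: "g \<in> hom C X Y"
    have X: "X \<in> Obj C" and Y: "Y \<in> Obj C" using homD[OF g] by auto
    have "component (omega_trans C k) Y \<cdot> g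
        = farr (omega_functor C N M) g \<cdot> component (omega_trans C k) X"
    proof (rule product_eqI[OF power_is_product[OF Y NM] comp_hom[OF hom[OF Y] g]
          comp_hom[OF omega_functor_arr_hom[OF NM g] hom[OF X]]])
      fix f assume f: "f \<in> hom C Y N"
      note p = product_proj[OF power_is_product[OF Y NM] f]
      show "power_proj C M (hom C Y N) f \<cdot> (component (omega_trans C k) Y \<cdot> g)
          = power_proj C M (hom C Y N) f \<cdot> (farr (omega_functor C N M) g \<cdot> component (omega_trans C k) X)"
        using hom_assoc[OF p hom[OF Y] g] hom_assoc[OF p omega_functor_arr_hom[OF NM g] hom[OF X]]
          proj[OF Y f] omega_functor_arr_proj[OF NM g f] proj[OF X comp_hom[OF f g]]
          hom_assoc[OF k f g] by simp
    qed
    then show "component (omega_trans C k) Y \<cdot> farr (id_functor C) g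
        = farr (omega_functor C N M) g \<cdot> component (omega_trans C k) X"
      using homD[OF g] by (simp add: id_functor_def)
  qed
  moreover have "omega_trans C k = \<lparr>nt_dom = id_functor C, nt_cod = omega_functor C N M,
      component = component (omega_trans C k)\<rparr>"
    using homD[OF k] by (simp add: omega_trans_def)
  ultimately show ?thesis by simp
qed

text \<open>An arrow into a power is zero iff all its projections are: if they vanish, it has the
  same projections as the zero arrow \<open>z\<close>. The arrow \<open>s\<close> is arbitrary, so
  the test applies to each component of a transformation.\<close>

lemma omega_trans_zero_iff:
  assumes Z: "zero_object C Z" and k: "k \<in> hom C N M" and s: "s \<in> hom C Q L"
  shows "zero_arrow C (component (omega_trans C k) L \<cdot> s) \<longleftrightarrow>
    (\<forall>f\<in>hom C L N. zero_arrow C (k \<cdot> (f \<cdot> s)))"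
proof -
  have NM: "N \<in> Obj C" "M \<in> Obj C" and L: "L \<in> Obj C" and Q: "Q \<in> Obj C"
    using homD[OF k] homD[OF s] by auto
  note P = power_is_product[OF L NM]
  note W = omega_trans_component_hom[OF k L]
  note Ws = comp_hom[OF W s]
  have proj: "power_proj C M (hom C L N) f \<cdot> (component (omega_trans C k) L \<cdot> s) = k \<cdot> (f \<cdot> s)"
    if f: "f \<in> hom C L N" for f
    using hom_assoc[OF product_proj[OF P f] W s] omega_trans_component_proj[OF k L f]
      hom_assoc[OF k f s] by simp
  show ?thesis
  proof
    assume "zero_arrow C (component (omega_trans C k) L \<cdot> s)"
    then show "\<forall>f\<in>hom C L N. zero_arrow C (k \<cdot> (f \<cdot> s))"
      using zero_arrow_comp_left[OF _ Ws product_proj[OF P]] proj by metis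
  next
    assume 0: "\<forall>f\<in>hom C L N. zero_arrow C (k \<cdot> (f \<cdot> s))"
    obtain z where z: "z \<in> hom C Q (power_obj C M (hom C L N))" "zero_arrow C z"
      by (rule zero_arrow_exists[OF Z Q power_obj_closed[OF L NM]])
    have "component (omega_trans C k) L \<cdot> s = z"
    proof (rule product_eqI[OF P Ws z(1)])
      fix f assume f: "f \<in> hom C L N"
      note p = product_proj[OF P f]
      have "zero_arrow C (power_proj C M (hom C L N) f \<cdot> (component (omega_trans C k) L \<cdot> s))"
        using 0 f proj[OF f] by simp
      then show "power_proj C M (hom C L N) f \<cdot> (component (omega_trans C k) L \<cdot> s)
          = power_proj C M (hom C L N) f \<cdot> z"
        by (rule zero_arrow_unique[OF _ zero_arrow_comp_left[OF z(2,1) p] comp_hom[OF p Ws]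
              comp_hom[OF p z(1)]])
    qed
    then show "zero_arrow C (component (omega_trans C k) L \<cdot> s)" using z(2) by simp
  qed
qed

end

text \<open>Both conjuncts carry information: \<Sqinter> is a choice that is meaningful only when a
  greatest lower bound exists, and the first conjunct asserts this. The preradical is the class
  \<open>p\<close>, with \<open>\<tau>\<close> any representative and \<open>\<tau>'\<close> any
  cokernel of it.\<close>

theorem proposition7p14:
  fixes \<A> :: "('o, 'm) cat"
    and p :: "('o, 'm, 'o, 'm) nat_trans set"
    and \<tau> \<tau>' :: "('o, 'm, 'o, 'm) nat_trans"
  assumes "grothendieck_universe TYPE('u)"
    and "abelian_category \<A>"
    and "small_homs TYPE('u) \<A>"
    and "bicomplete TYPE('u) \<A>"
    and "locally_small TYPE('u) \<A>"
    and "p \<in> carrier (Pr \<A>)"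
    and "\<tau> \<in> p"
    and "is_cokernel (functor_cat \<A> \<A>) \<tau> \<tau>'"
  shows "is_glb (Pr \<A>) p {omega \<A> (component \<tau>' M) | M. M \<in> Obj \<A>}
       \<and> p = \<Sqinter>\<^bsub>Pr \<A>\<^esub> {omega \<A> (component \<tau>' M) | M. M \<in> Obj \<A>}"
proof -
  interpret A: abelian_category \<A> by fact
  interpret abelian_functor_category \<A> \<A> ..
  interpret P: category_with_hom_powers \<A>
  proof unfold_locales
    fix L N M assume LNM: "L \<in> Obj \<A>" "N \<in> Obj \<A>" "M \<in> Obj \<A>"
    have "complete_cat TYPE('u) \<A>" "small TYPE('u) (hom \<A> L N)"
      using assms(3,4) LNM by (simp_all add: bicomplete_def small_homs_def)
    then show "\<exists>P \<pi>. is_product \<A> (hom \<A> L N) (\<lambda>i. M) P \<pi>"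
      using LNM(3) by (rule powers_exist[OF A.category_axioms])
  qed
  let ?F = "functor_cat \<A> \<A>" and ?I = "id_functor \<A>"
  obtain Z where Z: "zero_object \<A> Z" using A.has_zero_object by blast
  note zero_iff = zero_arrow_functor_cat[OF Z]
  have carrier: "carrier (Pr \<A>) = subobjects ?F ?I"
    by (simp add: Pr_def subobject_order_def)
  have le: "le (Pr \<A>) s t \<longleftrightarrow> (\<exists>m\<in>s. \<exists>n\<in>t. factors_through ?F m n)" for s t
    by (simp add: Pr_def subobject_order_def)
  have I: "fobj ?I M = M" if "M \<in> Obj \<A>" for M
    using that by (simp add: id_functor_def)
  have p: "p \<in> subobjects ?F ?I" using assms(6) carrier by simp
  note \<tau> = conjunct1[OF Fun.monics_intoD[OF Fun.subobject_member[OF p assms(7)]]]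
    conjunct2[OF Fun.monics_intoD[OF Fun.subobject_member[OF p assms(7)]]]
  define T where "T = Dom ?F \<tau>"
  define T' where "T' = Cod ?F \<tau>'"
  have \<tau>T: "\<tau> \<in> hom ?F T ?I" using \<tau>(2) by (simp add: T_def)
  interpret opF: category "op_cat ?F" by (rule Fun.category_op)
  have \<tau>op: "\<tau> \<in> hom (op_cat ?F) ?I T" using \<tau>T by simp
  note cok = assms(8)[unfolded is_cokernel_def]
  have \<tau>': "\<tau>' \<in> hom ?F ?I T'"
    using opF.kernel_hom[OF cok \<tau>op] by (simp add: T'_def)
  have "zero_arrow ?F (\<tau>' \<cdot>\<^bsub>?F\<^esub> \<tau>)"
    using opF.kernel_zero[OF cok \<tau>op] by simp
  then have \<tau>'\<tau>: "zero_arrow \<A> (component \<tau>' M \<cdot>\<^bsub>\<A>\<^esub> component \<tau> M)" if "M \<in> Obj \<A>" for M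
    using zero_iff[OF Fun.comp_hom[OF \<tau>' \<tau>T]] that by simp
  have k: "component \<tau>' M \<in> hom \<A> M (fobj T' M)" if "M \<in> Obj \<A>" for M
    using component_hom[OF \<tau>' that] I[OF that] by simp
  note W = P.omega_trans_hom[OF k]

  \<comment> \<open>\<open>Lower\<close> tests an element only against those members of the family
    that lie in the carrier, so a lower bound yields inequalities only once the omega preradicals
    are known to be subobjects.\<close>
  have omega_carrier: "omega \<A> (component \<tau>' M) \<in> subobjects ?F ?I" if M: "M \<in> Obj \<A>" for M
  proof -
    obtain \<kappa> where "is_kernel ?F (omega_trans \<A> (component \<tau>' M)) \<kappa>"
      by (rule functor_cat_kernel[OF W[OF M]], rule that)
    then show ?thesis
      unfolding omega_def by (rule Fun.Ker_subobject[OF _ W[OF M]])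
  qed
  \<comment> \<open>Two pointwise tests combined: a transformation is zero iff its components are,
    and an arrow into a power is zero iff its projections are.\<close>
  have zero_W_iff: "zero_arrow ?F (omega_trans \<A> (component \<tau>' M) \<cdot>\<^bsub>?F\<^esub> \<sigma>) \<longleftrightarrow>
      (\<forall>L\<in>Obj \<A>. \<forall>f\<in>hom \<A> L M. zero_arrow \<A> (component \<tau>' M \<cdot>\<^bsub>\<A>\<^esub> (f \<cdot>\<^bsub>\<A>\<^esub> component \<sigma> L)))"
    if M: "M \<in> Obj \<A>" and \<sigma>: "\<sigma> \<in> hom ?F S ?I" for M S \<sigma>
  proof -
    have "component \<sigma> L \<in> hom \<A> (fobj S L) L" if "L \<in> Obj \<A>" for L
      using component_hom[OF \<sigma> that] I[OF that] by simp
    note P.omega_trans_zero_iff[OF Z k[OF M] this]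
    then show ?thesis
      using zero_iff[OF Fun.comp_hom[OF W[OF M] \<sigma>]] by simp
  qed

  have lower: "le (Pr \<A>) p (omega \<A> (component \<tau>' M))" if M: "M \<in> Obj \<A>" for M
  proof -
    obtain \<kappa> where \<kappa>: "is_kernel ?F (omega_trans \<A> (component \<tau>' M)) \<kappa>"
      by (rule functor_cat_kernel[OF W[OF M]], rule that)
    have "zero_arrow ?F (omega_trans \<A> (component \<tau>' M) \<cdot>\<^bsub>?F\<^esub> \<tau>)"
      unfolding zero_W_iff[OF M \<tau>T]
    proof (intro ballI)
      fix L f assume L: "L \<in> Obj \<A>" and f: "f \<in> hom \<A> L M"
      have \<tau>M: "component \<tau> M \<in> hom \<A> (fobj T M) M"
        using component_hom[OF \<tau>T M] I[OF M] by simp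
      note Tf = functor_arr[OF nat_trans_dom[OF \<tau>T] f]
      \<comment> \<open>Moves \<open>\<tau>\<close> next to \<open>\<tau>'\<close> at the object
        \<open>M\<close>, where the composite is already known to be zero.\<close>
      have "f \<cdot>\<^bsub>\<A>\<^esub> component \<tau> L = component \<tau> M \<cdot>\<^bsub>\<A>\<^esub> farr T f"
        using naturality[OF \<tau>T f] A.homD[OF f] by (simp add: id_functor_def)
      then show "zero_arrow \<A> (component \<tau>' M \<cdot>\<^bsub>\<A>\<^esub> (f \<cdot>\<^bsub>\<A>\<^esub> component \<tau> L))"
        using A.zero_arrow_comp_right[OF \<tau>'\<tau>[OF M] A.comp_hom[OF k[OF M] \<tau>M] Tf]
          A.hom_assoc[OF k[OF M] \<tau>M Tf] by simp
    qed
    then obtain u where "u \<in> hom ?F T (Dom ?F \<kappa>)" "\<kappa> \<cdot>\<^bsub>?F\<^esub> u = \<tau>"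
      using Fun.kernel_lift[OF \<kappa> W[OF M] \<tau>T] by blast
    then have "factors_through ?F \<tau> \<kappa>"
      unfolding factors_through_def T_def by metis
    then show ?thesis
      using assms(7) \<kappa> unfolding le omega_def Ker_def by blast
  qed

  have greatest: "le (Pr \<A>) s p"
    if s: "s \<in> subobjects ?F ?I" and s_le: "\<And>M. M \<in> Obj \<A> \<Longrightarrow> le (Pr \<A>) s (omega \<A> (component \<tau>' M))" for s
  proof -
    \<comment> \<open>The zero object shows that the family of omega preradicals is nonempty; one
      inequality from it provides a representative \<open>\<sigma>\<close> of
      \<open>s\<close>.\<close>
    have "Z \<in> Obj \<A>" using Z unfolding zero_object_def by (elim conjE)
    from s_le[OF this] obtain \<sigma> where \<sigma>: "\<sigma> \<in> s"
      unfolding le by (elim bexE)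
    define S where "S = Dom ?F \<sigma>"
    have \<sigma>S: "\<sigma> \<in> hom ?F S ?I"
      using Fun.monics_intoD[OF Fun.subobject_member[OF s \<sigma>]] by (simp add: S_def)
    have "zero_arrow \<A> (component \<tau>' M \<cdot>\<^bsub>\<A>\<^esub> component \<sigma> M)" if M: "M \<in> Obj \<A>" for M
    proof -
      obtain m \<kappa> where m: "m \<in> s" "is_kernel ?F (omega_trans \<A> (component \<tau>' M)) \<kappa>" "factors_through ?F m \<kappa>"
        using s_le[OF M] unfolding le omega_def Ker_def by blast
      note \<kappa> = Fun.kernel_hom[OF m(2) W[OF M]]
      \<comment> \<open>The witness \<open>m\<close> of the inequality varies with \<open>M\<close>.
        Members of one subobject factor through each other, so the fixed \<open>\<sigma>\<close> can
        replace it for every \<open>M\<close>.\<close>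
      have "factors_through ?F \<sigma> \<kappa>"
        using Fun.factors_through_trans[OF Fun.subobject_members_equivalent[OF s \<sigma> m(1)] m(3)]
          Fun.homD[OF \<kappa>] by blast
      then obtain u where u: "u \<in> hom ?F S (Dom ?F \<kappa>)" "\<sigma> = \<kappa> \<cdot>\<^bsub>?F\<^esub> u"
        unfolding factors_through_def S_def by blast
      have "zero_arrow ?F (omega_trans \<A> (component \<tau>' M) \<cdot>\<^bsub>?F\<^esub> \<sigma>)"
        using Fun.zero_arrow_comp_right[OF Fun.kernel_zero[OF m(2) W[OF M]] Fun.comp_hom[OF W[OF M] \<kappa>] u(1)]
          Fun.hom_assoc[OF W[OF M] \<kappa> u(1)] u(2) by simp
      then have "zero_arrow \<A> (component \<tau>' M \<cdot>\<^bsub>\<A>\<^esub> (Ident \<A> M \<cdot>\<^bsub>\<A>\<^esub> component \<sigma> M))"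
        using zero_W_iff[OF M \<sigma>S] M A.Ident_hom[OF M] by blast
      then show ?thesis
        using A.hom_Ident_left component_hom[OF \<sigma>S M] I[OF M] by simp
    qed
    then have "factors_through ?F \<sigma> \<tau>"
      by (rule factors_through_if_cokernel_zero[OF \<tau>(1) \<tau>T assms(8) \<sigma>S])
    then show ?thesis using \<sigma> assms(7) unfolding le by blast
  qed

  have glb: "is_glb (Pr \<A>) p {omega \<A> (component \<tau>' M) | M. M \<in> Obj \<A>}"
    unfolding greatest_def
  proof (intro conjI ballI)
    show "Lower (Pr \<A>) {omega \<A> (component \<tau>' M) | M. M \<in> Obj \<A>} \<subseteq> carrier (Pr \<A>)"
      unfolding Lower_def by blast
    show "p \<in> Lower (Pr \<A>) {omega \<A> (component \<tau>' M) | M. M \<in> Obj \<A>}"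
      using assms(6) lower unfolding Lower_def by blast
    fix s assume "s \<in> Lower (Pr \<A>) {omega \<A> (component \<tau>' M) | M. M \<in> Obj \<A>}"
    then show "le (Pr \<A>) s p"
      using omega_carrier unfolding Lower_def carrier by (intro greatest) blast+
  qed
  then show ?thesis
    using Fun.is_glb_subobject_inf unfolding Pr_def by blast
qed

end
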